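(* Let $\mathcal{A}$ be a unital involutive Banach algebra with identity $1$ of norm one. Then the following are equivalent: \begin{enumerate} \item[(1)] The involution is continuous, and, if $\omega$ is a continuous linear functional on $\mathcal{A}$ such that $\Vert\omega\Vert=\omega(1)$, then $\omega$ is positive, i.e. $\omega(a^{\ast}a)\geq 0$ for all $a\in\mathcal{A}$; \item[(2)] The involution is continuous, and, if $\omega$ is a continuous linear functional on $\mathcal{A}$ such that $\Vert\omega\Vert=\omega(1)$, and $a\in\mathcal{A}$ is self-adjoint (i.e. $a^{\ast}=a$), then $\omega(a^{2})$ is real; \item[(3)] $\mathcal{A}$ is a $C^{\ast}$-algebra with the given norm and involution. \end{enumerate}
   Context: All algebras are over $\mathbb{C}$, and linear functionals are complex-linear maps $\omega:\mathcal{A}\to\mathbb{C}$. An involutive Banach algebra is a complex Banach algebra $\mathcal{A}$ (complete, with submultiplicative norm) equipped with an involution $a\mapsto a^{\ast}$, that is, a conjugate-linear map with $(ab)^{\ast}=b^{\ast}a^{\ast}$ and $(a^{\ast})^{\ast}=a$ for all $a,b\in\mathcal{A}$; the involution is not assumed to be isometric or even continuous unless explicitly stated. A linear functional $\omega$ on $\mathcal{A}$ is called positive if $\omega(a^{\ast}a)\geq 0$ (in particular, real) for all $a\in\mathcal{A}$. $\Vert\omega\Vert$ denotes the usual dual (operator) norm of a continuous linear functional. That $\mathcal{A}$ is a $C^{\ast}$-algebra with the given norm and involution means that $\Vert a^{\ast}a\Vert=\Vert a\Vert^{2}$ for all $a\in\mathcal{A}$. *)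

theory Defs
  imports "HOL-Analysis.Analysis"
begin

text \<open>
  Completeness, submultiplicativity of the norm and \<open>norm 1 = 1\<close> come from the sort
  \<open>{real_normed_algebra_1, banach}\<close>.  The library has only real scalars in its classes, so complex
  scalar multiplication is a locale parameter, required to extend \<open>scaleR\<close>.
\<close>

locale unital_complex_banach_algebra = vector_space scaleC
  for scaleC :: "complex \<Rightarrow> 'a::{real_normed_algebra_1, banach} \<Rightarrow> 'a" (infixr \<open>*\<^sub>C\<close> 75) +
  assumes scaleC_of_real: "complex_of_real r *\<^sub>C a = r *\<^sub>R a"
    and mult_scaleC_left: "(c *\<^sub>C a) * b = c *\<^sub>C (a * b)"
    and mult_scaleC_right: "a * (c *\<^sub>C b) = c *\<^sub>C (a * b)"
    and norm_scaleC: "norm (c *\<^sub>C a) = cmod c * norm a"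

text \<open>No continuity of the involution is assumed.\<close>

locale unital_involutive_banach_algebra = unital_complex_banach_algebra scaleC
  for scaleC :: "complex \<Rightarrow> 'a::{real_normed_algebra_1, banach} \<Rightarrow> 'a" (infixr \<open>*\<^sub>C\<close> 75) +
  fixes star :: "'a \<Rightarrow> 'a"
  assumes star_add: "star (a + b) = star a + star b"
    and star_scaleC: "star (c *\<^sub>C a) = cnj c *\<^sub>C star a"
    and star_mult: "star (a * b) = star b * star a"
    and star_star: "star (star a) = a"

locale unital_cstar_algebra = unital_involutive_banach_algebra scaleC star
  for scaleC :: "complex \<Rightarrow> 'a::{real_normed_algebra_1, banach} \<Rightarrow> 'a" (infixr \<open>*\<^sub>C\<close> 75)
    and star :: "'a \<Rightarrow> 'a" +
  assumes cstar_identity: "norm (star a * a) = (norm a)\<^sup>2"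

definition continuous_linear_functional ::
  "(complex \<Rightarrow> 'a::real_normed_vector \<Rightarrow> 'a) \<Rightarrow> ('a \<Rightarrow> complex) \<Rightarrow> bool"
  where "continuous_linear_functional scaleC \<omega> \<longleftrightarrow>
    Vector_Spaces.linear scaleC (*) \<omega> \<and> continuous_on UNIV \<omega>"

definition positive_functional ::
  "('a::times \<Rightarrow> 'a) \<Rightarrow> ('a \<Rightarrow> complex) \<Rightarrow> bool"
  where "positive_functional star \<omega> \<longleftrightarrow> (\<forall>a. \<omega> (star a * a) \<in> \<real>\<^sub>\<ge>\<^sub>0)"

end

theory Submission
  imports Defs "HOL-Complex_Analysis.Conformal_Mappings"
begin

text \<open>
  A functional with \<open>norm \<omega> = \<omega> 1\<close> is a nonnegative multiple of a state.  Expanding \<open>(1 + h)\<^sup>2\<close>, condition (2)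
  says that states are real on self-adjoint elements.  By Lumer's formula this gives
  \<open>norm ((s - i k)\<inverse>) \<le> 1 / s\<close> for \<open>s > 0\<close> and self-adjoint \<open>k\<close>, hence \<open>norm (1 + i k) \<le> 1 + (norm k)\<^sup>2\<close>, so that
  every unitary connected to \<open>1\<close> by a path of unitaries has norm at most \<open>1\<close>.  If \<open>norm (x\<^sup>* x) < 1\<close>,
  then \<open>x\<close> is the value at \<open>l = 0\<close> of Harris' function
  \<open>(1 - x x\<^sup>*)\<^bsup>-1/2\<^esup> (x + l) (1 + l x\<^sup>*)\<inverse> (1 - x\<^sup>* x)\<^bsup>1/2\<^esup>\<close>, which is holomorphic on the unit disc with such unitaries as
  boundary values; so \<open>norm x \<le> 1\<close>.  Therefore \<open>(norm x)\<^sup>2 \<le> norm (x\<^sup>* x)\<close>, which forces the \<open>C\<^sup>*\<close>-identity.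

  Conversely, in a \<open>C\<^sup>*\<close>-algebra states are real on self-adjoint elements, because
  \<open>(norm (t + i h))\<^sup>2 \<le> t\<^sup>2 + (norm h)\<^sup>2\<close> for real \<open>t\<close>, and nonnegative on \<open>x\<^sup>* x\<close>.
\<close>

section \<open>The Hahn--Banach theorem\<close>

text \<open>A state is handled through its real part \<open>f\<close>, since
  \<open>complexify\<close> recovers it; being real at \<open>h\<close> then reads
  \<open>f (\<i> *\<^sub>C h) = 0\<close>, a statement about one-sided derivatives of the norm. The
  resolvent bound leaves an error quadratic in \<open>norm k\<close>, with no linear term, so a
  finely subdivided path of unitaries costs nothing in the limit. The obstacle is that
  \<open>star\<close> is continuous but not known to be isometric, so smallness of
  \<open>star x * x\<close> does not make \<open>x * star x\<close> small. Harris' square roots are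
  therefore built from summability of the norms of the powers of \<open>star x * x\<close>, a
  condition symmetric in the two factors. The final inequality forces the identity by cancellation:
  \<open>(norm x)\<^sup>2 \<le> norm (star x) * norm x\<close> gives
  \<open>norm x \<le> norm (star x)\<close>, so \<open>star\<close> is isometric, and
  submultiplicativity supplies the reverse estimate. In the converse direction, nonnegativity on
  \<open>star x * x\<close> lies deeper than reality on self-adjoint elements. It rests on the fact
  that states determine the norm of a self-adjoint element, obtained here from square roots instead
  of Gelfand theory.\<close>

definition sublinear :: "('a::real_vector \<Rightarrow> real) \<Rightarrow> bool"
  where "sublinear p \<longleftrightarrow> (\<forall>x y. p (x + y) \<le> p x + p y) \<and> (\<forall>t x. 0 \<le> t \<longrightarrow> p (t *\<^sub>R x) = t * p x)"

lemma sublinear_add: "sublinear p \<Longrightarrow> p (x + y) \<le> p x + p y"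
  and sublinear_scale: "sublinear p \<Longrightarrow> 0 \<le> t \<Longrightarrow> p (t *\<^sub>R x) = t * p x"
  by (auto simp: sublinear_def)

lemma sublinear_zero: "sublinear p \<Longrightarrow> p 0 = 0"
  using sublinear_scale[of p 0 0] by simp

lemma sublinear_neg: "sublinear p \<Longrightarrow> - p (- x) \<le> p x"
  using sublinear_add[of p x "- x"] sublinear_zero[of p] by simp

text \<open>The members of \<open>A\<close> need not be sublinear themselves; it is enough that some
  member lies below each sum or positive multiple. This fits chains, shifted functionals and
  difference quotients of the norm alike.\<close>

lemma sublinear_INF:
  assumes A: "A \<noteq> {}"
    and bdd: "\<And>x. bdd_below ((\<lambda>q. q x) ` A)"
    and add: "\<And>q r x y. q \<in> A \<Longrightarrow> r \<in> A \<Longrightarrow> \<exists>s\<in>A. s (x + y) \<le> q x + r y"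
    and scale: "\<And>q t x. q \<in> A \<Longrightarrow> 0 < t \<Longrightarrow> \<exists>s\<in>A. s (t *\<^sub>R x) \<le> t * q x"
    and zero: "(INF q\<in>A. q 0) = 0"
  shows "sublinear (\<lambda>x. INF q\<in>A. q x)"
  unfolding sublinear_def
proof (intro conjI allI impI)
  let ?p = "\<lambda>x. INF q\<in>A. q x"
  fix x y
  have "?p (x + y) - r y \<le> ?p x" if r: "r \<in> A" for r
  proof (rule cINF_greatest[OF A])
    fix q assume "q \<in> A"
    then obtain s where s: "s \<in> A" "s (x + y) \<le> q x + r y" using add r by blast
    show "?p (x + y) - r y \<le> q x" using cINF_lower[OF bdd s(1), of "x + y"] s(2) by simp
  qed
  then have "?p (x + y) - ?p x \<le> ?p y"
    by (intro cINF_greatest[OF A]) (simp add: algebra_simps)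
  then show "?p (x + y) \<le> ?p x + ?p y" by simp
next
  let ?p = "\<lambda>x. INF q\<in>A. q x"
  fix t :: real and x assume t: "0 \<le> t"
  have le: "?p (t *\<^sub>R x) \<le> t * ?p x" if t: "0 < t" for t x
  proof -
    have "?p (t *\<^sub>R x) / t \<le> ?p x"
    proof (rule cINF_greatest[OF A])
      fix q assume "q \<in> A"
      then obtain s where s: "s \<in> A" "s (t *\<^sub>R x) \<le> t * q x" using scale t by blast
      then have "?p (t *\<^sub>R x) \<le> t * q x" using cINF_lower[OF bdd s(1), of "t *\<^sub>R x"] by simp
      then show "?p (t *\<^sub>R x) / t \<le> q x" using t by (simp add: field_simps)
    qed
    then show ?thesis using t by (simp add: field_simps)
  qed
  show "?p (t *\<^sub>R x) = t * ?p x"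
  proof (cases "t = 0")
    case True then show ?thesis using zero by simp
  next
    case False
    then have "0 < t" using t by simp
    then have "?p x \<le> inverse t * ?p (t *\<^sub>R x)" using le[of "inverse t" "t *\<^sub>R x"] by simp
    then have "t * ?p x \<le> ?p (t *\<^sub>R x)" using \<open>0 < t\<close> by (simp add: field_simps)
    then show ?thesis using le[OF \<open>0 < t\<close>, of x] by simp
  qed
qed

text \<open>The new functional is \<open>inf\<^sub>t (p (x + t z) - t p z)\<close>; taking \<open>x = - z\<close>, \<open>t = 1\<close> shows why it helps.\<close>

lemma sublinear_flatten:
  assumes p: "sublinear p"
  obtains q where "sublinear q" "\<And>x. q x \<le> p x" "q (- z) \<le> - p z"
proof -
  define A where "A = (\<lambda>t x. p (x + t *\<^sub>R z) - t * p z) ` {0::real..}"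
  have lower: "- p (- x) \<le> p (x + t *\<^sub>R z) - t * p z" if "0 \<le> t" for t x
    using sublinear_add[OF p, of "x + t *\<^sub>R z" "- x"] sublinear_scale[OF p that, of z] by simp
  have ge: "- p (- x) \<le> q x" if "q \<in> A" for q x
    using that lower by (auto simp: A_def)
  have bdd: "bdd_below ((\<lambda>q. q x) ` A)" for x
    unfolding bdd_below_def using ge by blast
  have A0: "p \<in> A" unfolding A_def by (rule image_eqI[of _ _ 0]) auto
  have zero: "(INF q\<in>A. q 0) = 0"
  proof (rule antisym)
    show "(INF q\<in>A. q 0) \<le> 0" using cINF_lower[OF bdd A0, of 0] sublinear_zero[OF p] by simp
    show "0 \<le> (INF q\<in>A. q 0)"
      using A0 ge[of _ 0] sublinear_zero[OF p] by (intro cINF_greatest) auto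
  qed
  have "sublinear (\<lambda>x. INF q\<in>A. q x)"
  proof (rule sublinear_INF[OF _ bdd _ _ zero])
    show "A \<noteq> {}" using A0 by auto
  next
    fix q r x y assume "q \<in> A" "r \<in> A"
    then obtain s t where st: "0 \<le> s" "0 \<le> t" "q = (\<lambda>x. p (x + s *\<^sub>R z) - s * p z)"
        "r = (\<lambda>x. p (x + t *\<^sub>R z) - t * p z)" by (auto simp: A_def)
    have "(\<lambda>x. p (x + (s + t) *\<^sub>R z) - (s + t) * p z) \<in> A" using st by (auto simp: A_def)
    moreover have "p (x + y + (s + t) *\<^sub>R z) - (s + t) * p z \<le> q x + r y"
      using sublinear_add[OF p, of "x + s *\<^sub>R z" "y + t *\<^sub>R z"] st
      by (simp add: algebra_simps)
    ultimately show "\<exists>s\<in>A. s (x + y) \<le> q x + r y"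
      by (intro bexI[where x = "\<lambda>x. p (x + (s + t) *\<^sub>R z) - (s + t) * p z"])
  next
    fix q t x assume "q \<in> A" "0 < (t::real)"
    then obtain s where s: "0 \<le> s" "q = (\<lambda>x. p (x + s *\<^sub>R z) - s * p z)" by (auto simp: A_def)
    have "(\<lambda>x. p (x + (t * s) *\<^sub>R z) - (t * s) * p z) \<in> A" using s \<open>0 < t\<close> by (auto simp: A_def)
    moreover have "p (t *\<^sub>R x + (t * s) *\<^sub>R z) - (t * s) * p z \<le> t * q x"
      using sublinear_scale[OF p, of t "x + s *\<^sub>R z"] s \<open>0 < t\<close>
      by (simp add: algebra_simps)
    ultimately show "\<exists>s\<in>A. s (t *\<^sub>R x) \<le> t * q x"
      by (intro bexI[where x = "\<lambda>x. p (x + (t * s) *\<^sub>R z) - (t * s) * p z"])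
  qed
  moreover have "(INF q\<in>A. q x) \<le> p x" for x
    using cINF_lower[OF bdd A0] .
  moreover have "(INF q\<in>A. q (- z)) \<le> - p z"
  proof -
    have "(\<lambda>x. p (x + 1 *\<^sub>R z) - 1 * p z) \<in> A" unfolding A_def by (rule image_eqI[of _ _ 1]) auto
    from cINF_lower[OF bdd this, of "- z"] show ?thesis using sublinear_zero[OF p] by simp
  qed
  ultimately show thesis by (rule that)
qed

text \<open>By minimality, flattening along \<open>z\<close> returns \<open>p\<close> itself. Hence
  \<open>p\<close> is odd, and oddness turns subadditivity into additivity.\<close>

lemma minimal_sublinear_linear:
  assumes p: "sublinear p" and min: "\<And>q. sublinear q \<Longrightarrow> (\<And>x. q x \<le> p x) \<Longrightarrow> q = p"
  shows "linear p"
proof -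
  have neg: "p (- z) = - p z" for z
  proof -
    obtain q where "sublinear q" "\<And>x. q x \<le> p x" "q (- z) \<le> - p z"
      using sublinear_flatten[OF p] by blast
    then have "p (- z) \<le> - p z" using min by blast
    then show ?thesis using sublinear_neg[OF p, of z] by simp
  qed
  show ?thesis
  proof (rule linearI)
    fix x y
    have "p (- x + - y) \<le> p (- x) + p (- y)" by (rule sublinear_add[OF p])
    then have "p x + p y \<le> p (x + y)" using neg[of x] neg[of y] neg[of "x + y"] by simp
    then show "p (x + y) = p x + p y" using sublinear_add[OF p, of x y] by simp
  next
    fix t :: real and x
    show "p (t *\<^sub>R x) = t *\<^sub>R p x"
    proof (cases "0 \<le> t")
      case True then show ?thesis using sublinear_scale[OF p] by simp
    next
      case False
      then have "p ((- t) *\<^sub>R x) = (- t) * p x" using sublinear_scale[OF p, of "- t" x] by simp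
      then show ?thesis using neg[of "t *\<^sub>R x"] by simp
    qed
  qed
qed

text \<open>Zorn's lemma for the reversed order. A nonempty chain has a finite pointwise infimum
  because \<open>q \<le> p\<close> forces \<open>- p (- x) \<le> q x\<close>.\<close>

lemma sublinear_dominates_linear:
  assumes p: "sublinear p"
  obtains f where "linear f" "\<And>x. f x \<le> p x"
proof -
  define A where "A = {q. sublinear q \<and> q \<le> p}"
  have lower: "- p (- x) \<le> q x" if "q \<in> A" for q x
    using that sublinear_neg[of q x] by (auto simp: A_def le_fun_def dest: spec[of _ "- x"])
  have "\<exists>m\<in>A. \<forall>q\<in>A. m \<ge> q \<longrightarrow> q = m"
  proof (rule predicate_Zorn[of A "\<lambda>q r. q \<ge> r"])
    show "partial_order_on A (relation_of (\<lambda>q r. q \<ge> r) A)"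
      by (rule partial_order_on_relation_ofI) auto
  next
    fix C assume C: "C \<in> Chains (relation_of (\<lambda>q r. q \<ge> r) A)"
    then have CA: "C \<subseteq> A" and tot: "\<And>q r. q \<in> C \<Longrightarrow> r \<in> C \<Longrightarrow> q \<le> r \<or> r \<le> q"
      by (auto simp: Chains_def relation_of_def)
    show "\<exists>u\<in>A. \<forall>q\<in>C. q \<ge> u"
    proof (cases "C = {}")
      case True then show ?thesis using p by (auto simp: A_def)
    next
      case False
      have bdd: "bdd_below ((\<lambda>q. q x) ` C)" for x
        unfolding bdd_below_def using lower CA by blast
      let ?u = "\<lambda>x. INF q\<in>C. q x"
      have le: "?u \<le> q" if "q \<in> C" for q
        using cINF_lower[OF bdd that] by (simp add: le_fun_def)
      have "sublinear ?u"
      proof (rule sublinear_INF[OF False bdd])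
        fix q r x y assume qr: "q \<in> C" "r \<in> C"
        then have sub: "sublinear q" "sublinear r" using CA by (auto simp: A_def)
        from tot[OF qr] show "\<exists>s\<in>C. s (x + y) \<le> q x + r y"
        proof
          assume "q \<le> r"
          then have "q y \<le> r y" by (simp add: le_fun_def)
          then show ?thesis using sublinear_add[OF sub(1), of x y] qr by (intro bexI[of _ q]) auto
        next
          assume "r \<le> q"
          then have "r x \<le> q x" by (simp add: le_fun_def)
          then show ?thesis using sublinear_add[OF sub(2), of x y] qr by (intro bexI[of _ r]) auto
        qed
      next
        fix q t x assume "q \<in> C" "0 < (t::real)"
        then show "\<exists>s\<in>C. s (t *\<^sub>R x) \<le> t * q x"
          using CA sublinear_scale[of q t x] by (intro bexI[of _ q]) (auto simp: A_def)
      next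
        have "(\<lambda>q. q 0) ` C = {0}"
          using False CA sublinear_zero by (fastforce simp: A_def)
        then show "(INF q\<in>C. q 0) = 0" by simp
      qed
      moreover have "?u \<le> p"
      proof -
        obtain q where "q \<in> C" using False by blast
        then show ?thesis using le[of q] CA by (auto simp: A_def intro: order_trans)
      qed
      ultimately show ?thesis using le by (auto simp: A_def)
    qed
  qed
  then obtain m where m: "m \<in> A" "\<And>q. q \<in> A \<Longrightarrow> q \<le> m \<Longrightarrow> q = m" by blast
  have "linear m"
  proof (rule minimal_sublinear_linear)
    show "sublinear m" using m by (simp add: A_def)
    fix q assume q: "sublinear q" "\<And>x. q x \<le> m x"
    then have "q \<le> m" by (simp add: le_fun_def)
    moreover have "m \<le> p" using m(1) by (simp add: A_def)
    ultimately show "q = m" using q(1) m(2)[of q] by (auto simp: A_def)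
  qed
  moreover have "m x \<le> p x" for x using m(1) by (simp add: A_def le_fun_def)
  ultimately show thesis by (rule that)
qed

text \<open>Flattening along \<open>z\<close> before passing to a linear minorant forces
  \<open>f (- z) \<le> - p z\<close>, hence equality at \<open>z\<close>.\<close>

theorem Hahn_Banach_sublinear:
  assumes p: "sublinear p"
  obtains f where "linear f" "\<And>x. f x \<le> p x" "f z = p z"
proof -
  obtain q where q: "sublinear q" "\<And>x. q x \<le> p x" "q (- z) \<le> - p z"
    using sublinear_flatten[OF p] by blast
  obtain f where f: "linear f" "\<And>x. f x \<le> q x"
    using sublinear_dominates_linear[OF q(1)] by blast
  have "f (- z) \<le> - p z" using f(2)[of "- z"] q(3) by simp
  then have "p z \<le> f z" using f(1) by (simp add: linear_neg)
  moreover have "f x \<le> p x" for x using f(2) q(2) order_trans by blast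
  ultimately show thesis using f(1) that[of f] by (simp add: antisym)
qed

lemma norm_mult3_ineq: "norm (a * b * c) \<le> norm a * norm b * norm c"
  for a :: "'a::real_normed_algebra"
  by (rule order_trans[OF norm_mult_ineq mult_right_mono[OF norm_mult_ineq norm_ge_zero]])

section \<open>Inverses and states in unital Banach algebras\<close>

definition inverses :: "'a::monoid_mult \<Rightarrow> 'a \<Rightarrow> bool"
  where "inverses a b \<longleftrightarrow> a * b = 1 \<and> b * a = 1"

lemma inverses_sym: "inverses a b \<Longrightarrow> inverses b a"
  by (simp add: inverses_def)


lemma inverses_left: "inverses a b \<Longrightarrow> a * (b * c) = c"
  and inverses_right: "inverses a b \<Longrightarrow> b * (a * c) = c"
  by (auto simp: inverses_def mult.assoc[symmetric])

lemma inverses_mult: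
  assumes "inverses a b" "inverses c d"
  shows "inverses (a * c) (d * b)"
  using assms inverses_left[OF assms(2), of b] inverses_right[OF assms(1), of c]
  by (simp add: inverses_def mult.assoc)

lemma inverses_unique: "inverses a b \<Longrightarrow> c * a = 1 \<Longrightarrow> c = b"
  unfolding inverses_def by (metis mult.assoc mult_1_left mult_1_right)

lemma left_right_inverses: "b * a = 1 \<Longrightarrow> a * c = 1 \<Longrightarrow> inverses a b"
  unfolding inverses_def by (metis mult.assoc mult_1_left mult_1_right)

lemma inverses_commute:
  assumes "inverses a b" "a * c = c * a"
  shows "b * c = c * b"
proof -
  have "b * c = b * (c * a) * b" using assms(1) by (simp add: inverses_def mult.assoc)
  also have "\<dots> = c * b" using assms inverses_right[OF assms(1)] by (simp add: assms(2)[symmetric] mult.assoc)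
  finally show ?thesis .
qed

lemma inverses_intertwine:
  assumes a: "inverses a a'" and b: "inverses b b'" and x: "x * a = b * x"
  shows "b' * x = x * a'"
proof -
  have "b' * x = b' * (x * a) * a'" using a by (simp add: inverses_def mult.assoc)
  also have "\<dots> = x * a'" using inverses_right[OF b, of x] by (simp add: x)
  finally show ?thesis .
qed

lemma inverses_scaleR:
  fixes a b :: "'a::real_algebra_1"
  shows "inverses a b \<Longrightarrow> s \<noteq> 0 \<Longrightarrow> inverses (s *\<^sub>R a) (inverse s *\<^sub>R b)"
  by (simp add: inverses_def)

lemma factor_of_invertible:
  assumes comm: "a * b = b * a" and inv: "inverses (a * b) c"
  obtains d where "inverses a d"
proof -
  have "c * b * a = 1" using inv comm by (simp add: inverses_def mult.assoc)
  moreover have "a * (b * c) = 1" using inv by (simp add: inverses_def mult.assoc)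
  ultimately show thesis using left_right_inverses that by blast
qed

text \<open>Jacobson's lemma. The witness comes from the formal Neumann series of the inverse of l -
  y x: every term after the first begins with y and ends with x, and together they contain the
  inverse of l - x y in between.\<close>

lemma inverses_swap:
  fixes x y :: "'a::real_algebra_1"
  assumes inv: "inverses (l *\<^sub>R 1 - x * y) r" and l: "l \<noteq> 0"
  obtains r' where "inverses (l *\<^sub>R 1 - y * x) r'"
proof (rule that)
  have 1: "x * y * r = l *\<^sub>R r - 1" "r * (x * y) = l *\<^sub>R r - 1"
    using inv by (auto simp: inverses_def algebra_simps)
  have "y * x * (y * r * x) = y * (x * y * r) * x" "y * r * x * (y * x) = y * (r * (x * y)) * x"
    by (simp_all add: mult.assoc)
  then have 2: "y * x * (y * r * x) = l *\<^sub>R (y * r * x) - y * x" "y * r * x * (y * x) = l *\<^sub>R (y * r * x) - y * x"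
    unfolding 1 by (simp_all add: algebra_simps)
  have "(l *\<^sub>R 1 - y * x) * (1 + y * r * x) = l *\<^sub>R 1" "(1 + y * r * x) * (l *\<^sub>R 1 - y * x) = l *\<^sub>R 1"
    using 2 by (simp_all add: left_diff_distrib right_diff_distrib distrib_left distrib_right scaleR_add_right)
  then show "inverses (l *\<^sub>R 1 - y * x) (inverse l *\<^sub>R (1 + y * r * x))"
    using l by (simp add: inverses_def del: scaleR_add_right)
qed

section \<open>Real parts of states and Lumer's formula\<close>

definition real_state :: "('a::real_normed_algebra_1 \<Rightarrow> real) \<Rightarrow> bool"
  where "real_state f \<longleftrightarrow> linear f \<and> (\<forall>x. f x \<le> norm x) \<and> f 1 = 1"

lemma real_state_linear: "real_state f \<Longrightarrow> linear f"
  and real_state_le: "real_state f \<Longrightarrow> f x \<le> norm x"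
  and real_state_one: "real_state f \<Longrightarrow> f 1 = 1"
  by (auto simp: real_state_def)

lemma real_state_add: "real_state f \<Longrightarrow> f (x + y) = f x + f y"
  and real_state_diff: "real_state f \<Longrightarrow> f (x - y) = f x - f y"
  and real_state_scale: "real_state f \<Longrightarrow> f (r *\<^sub>R x) = r * f x"
  and real_state_neg: "real_state f \<Longrightarrow> f (- x) = - f x"
  by (simp_all add: real_state_linear linear_add linear_diff linear_scale linear_neg)

lemmas real_state_simps = real_state_one real_state_add real_state_diff real_state_scale real_state_neg

lemma real_state_abs: "real_state f \<Longrightarrow> \<bar>f x\<bar> \<le> norm x"
  using real_state_le[of f x] real_state_le[of f "- x"] by (simp add: real_state_neg abs_le_iff)

text \<open>Lumer's formula: the maximum of \<open>f y\<close> over all states is the one-sided derivative of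
  \<open>norm (1 + t y)\<close> at \<open>t = 0\<close>.\<close>

lemma state_bound_norm:
  fixes y :: "'a::real_normed_algebra_1"
  assumes y: "\<forall>f. real_state f \<longrightarrow> f y \<le> c" and e: "e > 0"
  obtains t where "t > 0" "norm (1 + t *\<^sub>R y) \<le> 1 + t * (c + e)"
proof -
  define A where "A = (\<lambda>t (x::'a). (norm (1 + t *\<^sub>R x) - 1) / t) ` {0::real<..}"
  have mem: "(\<lambda>x. (norm (1 + t *\<^sub>R x) - 1) / t) \<in> A" if "t > 0" for t
    using that by (auto simp: A_def)
  have A0: "A \<noteq> {}" using mem[of 1] by auto
  have lower: "- norm x \<le> (norm (1 + t *\<^sub>R x) - 1) / t" if "t > 0" for t and x :: 'a
  proof -
    have "norm (1::'a) \<le> norm (1 + t *\<^sub>R x) + norm (t *\<^sub>R x)"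
      using norm_triangle_ineq4[of "1 + t *\<^sub>R x" "t *\<^sub>R x"] by simp
    then show ?thesis using that by (simp add: field_simps)
  qed
  have bdd: "bdd_below ((\<lambda>q. q x) ` A)" for x
    unfolding bdd_below_def using lower by (auto simp: A_def)
  define p where "p = (\<lambda>x. INF q\<in>A. q x)"
  have p: "sublinear p" unfolding p_def
  proof (rule sublinear_INF[OF A0 bdd])
    fix q r and x y :: 'a assume "q \<in> A" "r \<in> A"
    then obtain s t where st: "0 < s" "0 < t" "q = (\<lambda>x. (norm (1 + s *\<^sub>R x) - 1) / s)"
        "r = (\<lambda>x. (norm (1 + t *\<^sub>R x) - 1) / t)" by (auto simp: A_def)
    \<comment> \<open>For this \<open>u\<close>, 1 + u (x + y) is a convex combination of 1 + s x
      and 1 + t y.\<close>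
    define u where "u = s * t / (s + t)"
    have u: "u > 0" using st by (simp add: u_def)
    have c: "u / s + u / t = 1" "u / s \<ge> 0" "u / t \<ge> 0"
    proof -
      have "u / s = t / (s + t)" "u / t = s / (s + t)" using st by (auto simp: u_def)
      then show "u / s + u / t = 1" "u / s \<ge> 0" "u / t \<ge> 0"
        using st by (auto simp: add_divide_distrib[symmetric])
    qed
    have "1 + u *\<^sub>R (x + y) = (u / s + u / t) *\<^sub>R 1 + u *\<^sub>R (x + y)" by (simp only: c scaleR_one)
    also have "\<dots> = (u / s) *\<^sub>R (1 + s *\<^sub>R x) + (u / t) *\<^sub>R (1 + t *\<^sub>R y)"
      using st by (simp add: algebra_simps)
    also have "norm \<dots> \<le> (u / s) * norm (1 + s *\<^sub>R x) + (u / t) * norm (1 + t *\<^sub>R y)"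
      using norm_triangle_ineq[of "(u / s) *\<^sub>R (1 + s *\<^sub>R x)" "(u / t) *\<^sub>R (1 + t *\<^sub>R y)"] u st by simp
    finally have "norm (1 + u *\<^sub>R (x + y)) - (u / s + u / t) \<le> u * (q x + r y)"
      using st by (simp add: field_simps)
    then have "(norm (1 + u *\<^sub>R (x + y)) - 1) / u \<le> q x + r y"
      using u c by (simp add: field_simps)
    then show "\<exists>s\<in>A. s (x + y) \<le> q x + r y"
      using mem[OF u] by (intro bexI[where x = "\<lambda>x. (norm (1 + u *\<^sub>R x) - 1) / u"])
  next
    fix q and x :: 'a and t :: real assume "q \<in> A" "0 < t"
    then obtain s where s: "0 < s" "q = (\<lambda>x. (norm (1 + s *\<^sub>R x) - 1) / s)" by (auto simp: A_def)
    have "(norm (1 + (s / t) *\<^sub>R (t *\<^sub>R x)) - 1) / (s / t) \<le> t * q x"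
      using s \<open>0 < t\<close> by (simp add: field_simps)
    then show "\<exists>s\<in>A. s (t *\<^sub>R x) \<le> t * q x"
      using s \<open>0 < t\<close> mem[of "s / t"]
      by (intro bexI[where x = "\<lambda>x. (norm (1 + (s / t) *\<^sub>R x) - 1) / (s / t)"]) auto
  next
    have "(\<lambda>q. q 0) ` A = {0}" by (auto simp: A_def image_image intro!: image_eqI[of _ _ 1])
    then show "(INF q\<in>A. q 0) = 0" by simp
  qed
  have le: "p x \<le> (norm (1 + t *\<^sub>R x) - 1) / t" if "t > 0" for t x
    unfolding p_def using cINF_lower[OF bdd mem[OF that]] .
  obtain f where f: "linear f" "\<And>x. f x \<le> p x" "f y = p y"
    using Hahn_Banach_sublinear[OF p] by blast
  have "real_state f"
    unfolding real_state_def
  proof (intro conjI allI f(1))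
    show *: "f x \<le> norm x" for x
      using f(2)[of x] le[of 1 x] norm_triangle_ineq[of 1 x] by simp
    \<comment> \<open>At \<open>- 1\<close> the difference quotient for \<open>t = 1 / 2\<close> is
      exactly \<open>- 1\<close>, so \<open>f (- 1) \<le> - 1\<close>.\<close>
    have "1 + (1 / 2) *\<^sub>R (- 1) = (1 - 1 / 2) *\<^sub>R (1::'a)"
      unfolding scaleR_left_diff_distrib by simp
    then have "1 + (1 / 2) *\<^sub>R (- 1) = (1 / 2) *\<^sub>R (1::'a)" by simp
    then have "f (- 1) \<le> - 1"
      using f(2)[of "- 1"] le[of "1 / 2" "- 1"] by simp
    then show "f 1 = 1" using *[of 1] f(1) by (simp add: linear_neg)
  qed
  then have "f y \<le> c" using y by blast
  then have "p y < c + e" using f(3) e by simp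
  then obtain q where "q \<in> A" "q y < c + e"
    unfolding p_def using cINF_less_iff[OF A0 bdd] by blast
  then obtain t where "t > 0" "(norm (1 + t *\<^sub>R y) - 1) / t < c + e" by (auto simp: A_def)
  then show thesis by (intro that[of t]) (simp_all add: divide_less_eq algebra_simps)
qed

text \<open>Split (1 + t s) z as (1 + t y) z + t (s - y) z and apply Lumer's estimate to the first
  summand. The terms of order zero in \<open>t\<close> cancel, and division by \<open>t\<close>
  leaves the claim up to \<open>d * norm z\<close>.\<close>

lemma state_bound_lower:
  fixes y :: "'a::real_normed_algebra_1"
  assumes y: "\<forall>f. real_state f \<longrightarrow> f y \<le> c"
  shows "(s - c) * norm z \<le> norm ((s *\<^sub>R 1 - y) * z)"
proof (rule field_le_epsilon)
  fix e :: real assume e: "e > 0"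
  define d where "d = e / (norm z + 1)"
  have d: "d > 0" using e by (simp add: d_def add_nonneg_pos)
  have "d * norm z \<le> d * (norm z + 1)" using d by simp
  also have "\<dots> = e" using norm_ge_zero[of z] by (simp add: d_def del: norm_ge_zero)
  finally have dz: "d * norm z \<le> e" .
  obtain t where t: "t > 0" "norm (1 + t *\<^sub>R y) \<le> 1 + t * (c + d)"
    using state_bound_norm[OF y d] by blast
  have "(1 + t * s) *\<^sub>R z = (1 + t *\<^sub>R y) * z + t *\<^sub>R ((s *\<^sub>R 1 - y) * z)"
    by (simp add: algebra_simps)
  then have "norm ((1 + t * s) *\<^sub>R z) \<le> norm ((1 + t *\<^sub>R y) * z) + t * norm ((s *\<^sub>R 1 - y) * z)"
    using norm_triangle_ineq[of "(1 + t *\<^sub>R y) * z" "t *\<^sub>R ((s *\<^sub>R 1 - y) * z)"] t by simp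
  moreover have "(1 + t * s) * norm z \<le> norm ((1 + t * s) *\<^sub>R z)"
    by (simp add: mult_right_mono)
  moreover have "norm ((1 + t *\<^sub>R y) * z) \<le> (1 + t * (c + d)) * norm z"
    using norm_mult_ineq t(2) by (meson mult_right_mono norm_ge_zero order_trans)
  ultimately have "t * ((s - c) * norm z) \<le> t * (norm ((s *\<^sub>R 1 - y) * z) + d * norm z)"
    by (simp add: algebra_simps)
  then show "(s - c) * norm z \<le> norm ((s *\<^sub>R 1 - y) * z) + e"
    using t(1) dz by simp
qed

subsection \<open>Binomial series\<close>

text \<open>The power (1 + y)^\<alpha>. Exponents 1/2 and -1/2 give square roots and their inverses,
  -1 the Neumann series. For \<open>\<bar>\<alpha>\<bar> \<le> 1\<close> the coefficients stay
  bounded by 1, so summability of the norms of the powers of \<open>y\<close> suffices, even when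
  \<open>norm y \<ge> 1\<close>.\<close>

definition binomial_series :: "real \<Rightarrow> 'a::{real_normed_algebra_1, banach} \<Rightarrow> 'a"
  where "binomial_series \<alpha> y = (\<Sum>n. (\<alpha> gchoose n) *\<^sub>R y ^ n)"

text \<open>Consecutive coefficients have ratio (\<alpha> - n) / (n + 1), of modulus at most
  1.\<close>

lemma abs_gbinomial_le_one:
  fixes \<alpha> :: real
  assumes "\<bar>\<alpha>\<bar> \<le> 1"
  shows "\<bar>\<alpha> gchoose n\<bar> \<le> 1"
proof (induction n)
  case (Suc n)
  have "real (Suc n) * (\<alpha> gchoose Suc n) = (\<alpha> - real n) * (\<alpha> gchoose n)"
    using gbinomial_mult_1[of \<alpha> n] by (simp add: algebra_simps)
  then have "real (Suc n) * \<bar>\<alpha> gchoose Suc n\<bar> = \<bar>\<alpha> - real n\<bar> * \<bar>\<alpha> gchoose n\<bar>"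
    by (metis abs_mult abs_of_nat)
  also have "\<dots> \<le> real (Suc n) * 1"
    using assms by (intro mult_mono Suc) auto
  finally show ?case using mult_le_cancel_left_pos[of "real (Suc n)"] by simp
qed simp

lemma summable_binomial_series:
  assumes "summable (\<lambda>n. norm (y ^ n))" "\<bar>\<alpha>\<bar> \<le> 1"
  shows "summable (\<lambda>n. norm ((\<alpha> gchoose n) *\<^sub>R y ^ n))"
proof (rule summable_comparison_test[OF _ assms(1)], intro exI allI impI)
  fix n
  have "\<bar>\<alpha> gchoose n\<bar> * norm (y ^ n) \<le> norm (y ^ n)"
    using abs_gbinomial_le_one[OF assms(2)] by (intro mult_left_le_one_le) auto
  then show "norm (norm ((\<alpha> gchoose n) *\<^sub>R y ^ n)) \<le> norm (y ^ n)" by simp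
qed

lemma binomial_series_sums:
  assumes "summable (\<lambda>n. norm (y ^ n))" "\<bar>\<alpha>\<bar> \<le> 1"
  shows "(\<lambda>n. (\<alpha> gchoose n) *\<^sub>R y ^ n) sums binomial_series \<alpha> y"
  unfolding binomial_series_def
  by (rule summable_sums[OF summable_norm_cancel[OF summable_binomial_series[OF assms]]])

lemma binomial_series_mult:
  assumes y: "summable (\<lambda>n. norm (y ^ n))" and "\<bar>\<alpha>\<bar> \<le> 1" "\<bar>\<beta>\<bar> \<le> 1"
  shows "binomial_series \<alpha> y * binomial_series \<beta> y = binomial_series (\<alpha> + \<beta>) y"
proof -
  have "(\<lambda>k. \<Sum>i\<le>k. ((\<alpha> gchoose i) *\<^sub>R y ^ i) * ((\<beta> gchoose (k - i)) *\<^sub>R y ^ (k - i)))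
      sums (binomial_series \<alpha> y * binomial_series \<beta> y)"
    unfolding binomial_series_def
    by (intro Cauchy_product_sums summable_binomial_series assms)
  moreover have "(\<Sum>i\<le>k. ((\<alpha> gchoose i) *\<^sub>R y ^ i) * ((\<beta> gchoose (k - i)) *\<^sub>R y ^ (k - i)))
      = ((\<alpha> + \<beta>) gchoose k) *\<^sub>R y ^ k" for k
    unfolding gbinomial_Vandermonde[symmetric] scaleR_sum_left
    by (intro sum.cong) (auto simp: power_add[symmetric] mult.commute)
  ultimately show ?thesis by (simp add: binomial_series_def sums_iff)
qed

lemma binomial_series_0: "binomial_series 0 y = 1"
proof -
  have "(\<lambda>n. ((0::real) gchoose n) *\<^sub>R y ^ n) sums (\<Sum>n\<in>{0}. ((0::real) gchoose n) *\<^sub>R y ^ n)"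
    by (rule sums_finite) (auto simp: gbinomial_0 dest!: gr0_implies_Suc)
  then show ?thesis by (simp add: binomial_series_def sums_iff)
qed

lemma binomial_series_1: "binomial_series 1 y = 1 + y"
proof -
  have "(\<lambda>n. ((1::real) gchoose n) *\<^sub>R y ^ n) sums (\<Sum>n\<in>{0,1}. ((1::real) gchoose n) *\<^sub>R y ^ n)"
  proof (rule sums_finite)
    fix n :: nat assume "n \<notin> {0, 1}"
    then have "(1::nat) < n" by auto
    then have "(1 choose n) = 0" by (rule binomial_eq_0)
    then have "((1::real) gchoose n) = 0"
      using binomial_gbinomial[of 1 n, where 'a = real] by (metis of_nat_0 of_nat_1)
    then show "((1::real) gchoose n) *\<^sub>R y ^ n = 0" by simp
  qed simp
  then show ?thesis by (simp add: binomial_series_def sums_iff)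
qed

lemma binomial_series_at_0: "binomial_series \<alpha> 0 = 1"
proof -
  have "(\<lambda>n. (\<alpha> gchoose n) *\<^sub>R 0 ^ n) sums (\<Sum>n\<in>{0}. (\<alpha> gchoose n) *\<^sub>R (0::'a) ^ n)"
    by (rule sums_finite) (auto simp: power_0_left)
  then show ?thesis by (simp add: binomial_series_def sums_iff)
qed

lemma binomial_series_intertwine:
  assumes yz: "summable (\<lambda>n. norm (y ^ n))" "summable (\<lambda>n. norm (z ^ n))" and \<alpha>: "\<bar>\<alpha>\<bar> \<le> 1"
    and x: "x * y = z * x"
  shows "x * binomial_series \<alpha> y = binomial_series \<alpha> z * x"
proof -
  have pow: "x * y ^ n = z ^ n * x" for n
    by (induction n) (auto simp: x mult.assoc[symmetric], simp add: x mult.assoc)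
  have "(\<lambda>n. x * ((\<alpha> gchoose n) *\<^sub>R y ^ n)) sums (x * binomial_series \<alpha> y)"
    by (intro sums_mult binomial_series_sums yz \<alpha>)
  moreover have "(\<lambda>n. ((\<alpha> gchoose n) *\<^sub>R z ^ n) * x) sums (binomial_series \<alpha> z * x)"
    by (intro sums_mult2 binomial_series_sums yz \<alpha>)
  ultimately show ?thesis using sums_unique2 by (simp add: pow)
qed

lemma summable_norm_power: "norm y < 1 \<Longrightarrow> summable (\<lambda>n. norm (y ^ n))"
  for y :: "'a::real_normed_algebra_1"
  by (rule summable_comparison_test[of _ "\<lambda>n. norm y ^ n"]) (simp_all add: norm_power_ineq summable_geometric)

lemma summable_norm_power_scaleR:
  fixes y :: "'a::real_normed_algebra_1"
  assumes "summable (\<lambda>n. norm (y ^ n))" "\<bar>t\<bar> \<le> 1"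
  shows "summable (\<lambda>n. norm ((t *\<^sub>R y) ^ n))"
proof (rule summable_comparison_test[OF _ assms(1)], intro exI allI impI)
  fix n
  have "\<bar>t\<bar> ^ n \<le> 1" using assms(2) by (intro power_le_one) auto
  then have "\<bar>t\<bar> ^ n * norm (y ^ n) \<le> norm (y ^ n)" by (intro mult_left_le_one_le) auto
  then show "norm (norm ((t *\<^sub>R y) ^ n)) \<le> norm (y ^ n)" by (simp add: power_abs)
qed

lemma summable_norm_power_minus:
  fixes y :: "'a::real_normed_algebra_1"
  assumes "summable (\<lambda>n. norm (y ^ n))"
  shows "summable (\<lambda>n. norm ((- y) ^ n))"
proof -
  have "- y = (- 1) *\<^sub>R y" by simp
  then show ?thesis using summable_norm_power_scaleR[OF assms, of "- 1"] by (metis abs_minus_cancel abs_one order_refl)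
qed

text \<open>The reason for working with summable powers: \<open>norm (x * y) < 1\<close> need not
  pass to \<open>y * x\<close>, whereas summability does, because each power of \<open>y * x\<close>
  encloses the preceding power of \<open>x * y\<close>.\<close>

lemma summable_norm_power_swap:
  fixes x y :: "'a::real_normed_algebra_1"
  assumes "summable (\<lambda>n. norm ((x * y) ^ n))"
  shows "summable (\<lambda>n. norm ((y * x) ^ n))"
proof -
  have pow: "(y * x) ^ Suc n = y * (x * y) ^ n * x" for n
    by (induction n) (simp_all add: mult.assoc power_commutes)
  have "summable (\<lambda>n. (norm y * norm x) * norm ((x * y) ^ n))"
    by (intro summable_mult assms)
  moreover have "norm ((y * x) ^ Suc n) \<le> (norm y * norm x) * norm ((x * y) ^ n)" for n
    unfolding pow using norm_mult3_ineq[of y "(x * y) ^ n" x] by (simp add: mult_ac)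
  ultimately have "summable (\<lambda>n. norm ((y * x) ^ Suc n))"
    by (intro summable_comparison_test[of "\<lambda>n. norm ((y * x) ^ Suc n)" "\<lambda>n. norm y * norm x * norm ((x * y) ^ n)"])
       (simp_all del: power_Suc)
  then show ?thesis using summable_Suc_iff[of "\<lambda>n. norm ((y * x) ^ n)"] by blast
qed

lemma binomial_series_neg_inverses:
  assumes "summable (\<lambda>n. norm (y ^ n))" "\<bar>\<alpha>\<bar> \<le> 1"
  shows "inverses (binomial_series \<alpha> y) (binomial_series (- \<alpha>) y)"
  using binomial_series_mult[OF assms(1), of \<alpha> "- \<alpha>"] binomial_series_mult[OF assms(1), of "- \<alpha>" \<alpha>] assms(2)
  by (simp add: inverses_def binomial_series_0)

lemma binomial_series_half:
  assumes "summable (\<lambda>n. norm (y ^ n))"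
  shows "binomial_series (1/2) y * binomial_series (1/2) y = 1 + y"
  using binomial_series_mult[OF assms, of "1/2" "1/2"] by (simp add: binomial_series_1)

lemma continuous_on_binomial_series:
  assumes y: "summable (\<lambda>n. norm (y ^ n))" and \<alpha>: "\<bar>\<alpha>\<bar> \<le> 1"
  shows "continuous_on {-1..1} (\<lambda>t::real. binomial_series \<alpha> (t *\<^sub>R y))"
proof -
  have "uniform_limit {-1..1} (\<lambda>n t. \<Sum>i<n. (\<alpha> gchoose i) *\<^sub>R (t *\<^sub>R y) ^ i)
      (\<lambda>t. \<Sum>i. (\<alpha> gchoose i) *\<^sub>R (t *\<^sub>R y) ^ i) sequentially"
  proof (rule Weierstrass_m_test[OF _ y])
    fix n and t :: real assume "t \<in> {-1..1}"
    then have "\<bar>t\<bar> \<le> 1" by auto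
    then have "\<bar>\<alpha> gchoose n\<bar> * \<bar>t ^ n\<bar> \<le> 1"
      by (intro mult_le_one abs_gbinomial_le_one \<alpha>) (auto simp: power_abs power_le_one)
    then have "\<bar>\<alpha> gchoose n\<bar> * \<bar>t ^ n\<bar> * norm (y ^ n) \<le> norm (y ^ n)"
      by (intro mult_left_le_one_le) auto
    then show "norm ((\<alpha> gchoose n) *\<^sub>R (t *\<^sub>R y) ^ n) \<le> norm (y ^ n)"
      by (simp add: abs_mult mult.assoc)
  qed
  then show ?thesis
    unfolding binomial_series_def
    by (rule uniform_limit_theorem[rotated]) (auto intro!: always_eventually continuous_intros)
qed

subsection \<open>Resolvents\<close>

text \<open>Existence is the Neumann series for c = a (1 + b (c - a)). The bound avoids estimating
  that series: d = b - d (c - a) b gives \<open>norm d \<le> norm b + norm d / 2\<close>.\<close>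

lemma inverses_perturb:
  fixes a b :: "'a::{real_normed_algebra_1, banach}"
  assumes ab: "inverses a b" and c: "norm (c - a) * norm b \<le> 1 / 2"
  obtains d where "inverses c d" "norm d \<le> 2 * norm b"
proof -
  let ?z = "b * (c - a)"
  have "norm ?z \<le> norm b * norm (c - a)" by (rule norm_mult_ineq)
  then have z: "norm ?z \<le> 1 / 2" using c by (simp add: mult.commute)
  then have sm: "summable (\<lambda>n. norm (?z ^ n))" by (intro summable_norm_power) simp
  let ?n = "binomial_series (- 1) ?z"
  have "inverses (1 + ?z) ?n"
    using binomial_series_neg_inverses[OF sm, of 1] by (simp add: binomial_series_1)
  moreover have ceq: "c = a * (1 + ?z)"
    using inverses_left[OF ab] by (simp add: distrib_left)
  ultimately have inv: "inverses c (?n * b)"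
    using inverses_mult[OF ab] by metis
  have "?n * b = b - ?n * b * (c - a) * b"
    using inv ab by (simp add: inverses_def algebra_simps mult.assoc)
  then have "norm (?n * b) \<le> norm b + norm (?n * b * (c - a) * b)"
    by (metis norm_triangle_ineq4)
  also have "norm (?n * b * (c - a) * b) \<le> norm (?n * b) * (norm (c - a) * norm b)"
    using norm_mult3_ineq[of "?n * b" "c - a" b] by (simp add: mult.assoc)
  also have "\<dots> \<le> norm (?n * b) * (1 / 2)"
    by (intro mult_left_mono c) simp
  finally show thesis using inv that by simp
qed

text \<open>For large \<open>s\<close> the inverse exists; the norm bound then allows steps of a third of the distance to \<open>c\<close>.\<close>

lemma state_bound_resolvent:
  fixes y :: "'a::{real_normed_algebra_1, banach}"
  assumes y: "\<forall>f. real_state f \<longrightarrow> f y \<le> c" and s: "c < s"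
  obtains r where "inverses (s *\<^sub>R 1 - y) r" "norm r \<le> 1 / (s - c)"
proof -
  \<comment> \<open>If \<open>S \<le> s - c\<close>, then \<open>s > 0\<close> and
    \<open>2 * norm y \<le> s\<close>, so s - y is a small perturbation of the scalar s.\<close>
  define S where "S = 2 * norm y + \<bar>c\<bar> + 1"
  have bound: "norm r \<le> 1 / (s - c)" if "inverses (s *\<^sub>R 1 - y) r" "c < s" for s r
    using state_bound_lower[OF y, of s r] that by (simp add: inverses_def field_simps)
  have step: "\<exists>r. inverses (s *\<^sub>R 1 - y) r" if "c < s" "S * (2/3) ^ n \<le> s - c" for n s
    using that
  proof (induction n arbitrary: s)
    case 0
    then have S: "S \<le> s - c" by simp
    then have pos: "s > 0" and ys: "2 * norm y \<le> s" unfolding S_def using norm_ge_zero[of y] by linarith+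
    have "inverses (s *\<^sub>R 1) (inverse s *\<^sub>R 1 :: 'a)"
      using pos by (simp add: inverses_def)
    moreover have "norm ((s *\<^sub>R 1 - y) - s *\<^sub>R 1) * norm (inverse s *\<^sub>R 1 :: 'a) \<le> 1 / 2"
      using pos ys by (simp add: field_simps)
    ultimately show ?case using inverses_perturb by blast
  next
    case (Suc n)
    define s' where "s' = c + 3 / 2 * (s - c)"
    have s': "c < s'" using Suc.prems by (simp add: s'_def)
    moreover have "S * (2/3) ^ n \<le> s' - c" using Suc.prems by (simp add: s'_def)
    ultimately obtain r where r: "inverses (s' *\<^sub>R 1 - y) r" using Suc.IH by blast
    have dist: "norm ((s *\<^sub>R 1 - y) - (s' *\<^sub>R 1 - y)) = (s - c) / 2"
    proof -
      have "(s *\<^sub>R 1 - y) - (s' *\<^sub>R 1 - y) = - (((s - c) / 2) *\<^sub>R (1::'a))"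
        unfolding s'_def by (simp add: algebra_simps flip: scaleR_add_left)
           (simp add: field_simps flip: scaleR_add_left scaleR_diff_left)
      then show ?thesis using Suc.prems by (simp del: scaleR_minus_left)
    qed
    have "norm ((s *\<^sub>R 1 - y) - (s' *\<^sub>R 1 - y)) * norm r \<le> (s - c) / 2 * (1 / (s' - c))"
      unfolding dist using Suc.prems bound[OF r s'] by (intro mult_left_mono) auto
    also have "\<dots> \<le> 1 / 2" using Suc.prems by (simp add: s'_def)
    finally show ?case using inverses_perturb[OF r] by blast
  qed
  have "(\<lambda>n. S * (2/3) ^ n) \<longlonglongrightarrow> S * 0"
    by (intro tendsto_mult_left LIMSEQ_power_zero) simp
  then have "\<forall>\<^sub>F n in sequentially. S * (2/3) ^ n < s - c"
    using s by (auto dest!: order_tendstoD(2)[of _ _ _ "s - c"])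
  then obtain n where "S * (2/3) ^ n < s - c" by (auto simp: eventually_sequentially)
  then obtain r where "inverses (s *\<^sub>R 1 - y) r" using step[OF s, of n] by auto
  then show thesis using bound s that by blast
qed

text \<open>A converse to the resolvent bound, read off from the expansion s^2 r = s - q + q^2 r for
  large s: since \<open>f r \<le> 1 / s\<close>, it yields
  \<open>- f q \<le> norm (q * q) / s\<close>. The chosen \<open>s\<close> makes this fail when
  \<open>f q\<close> is negative.\<close>

lemma state_nonneg_of_resolvent:
  fixes q :: "'a::{real_normed_algebra_1, banach}"
  assumes f: "real_state f"
    and r: "\<And>s. s > 0 \<Longrightarrow> \<exists>r. inverses (s *\<^sub>R 1 + q) r \<and> norm r \<le> 1 / s"
  shows "0 \<le> f q"
proof (rule ccontr)
  assume neg: "\<not> 0 \<le> f q"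
  define s where "s = (norm (q * q) + 1) / - f q"
  have s: "s > 0" using neg by (simp add: s_def add_nonneg_pos divide_nonneg_neg divide_pos_neg)
  obtain r where r: "inverses (s *\<^sub>R 1 + q) r" "norm r \<le> 1 / s" using r[OF s] by blast
  have 1: "s *\<^sub>R r = 1 - q * r" using r(1) by (simp add: inverses_def algebra_simps)
  have "s *\<^sub>R (s *\<^sub>R r) = s *\<^sub>R 1 - q * (s *\<^sub>R r)" by (subst 1) (simp add: algebra_simps)
  also have "\<dots> = s *\<^sub>R 1 - q + q * q * r" by (subst 1) (simp add: algebra_simps)
  finally have "f (s *\<^sub>R (s *\<^sub>R r)) = f (s *\<^sub>R 1 - q + q * q * r)" by (rule arg_cong)
  then have "s * s * f r = s - f q + f (q * q * r)"
    by (simp only: real_state_simps[OF f] mult.assoc mult_1_right)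
  moreover have "s * s * f r \<le> s"
  proof -
    have "f r \<le> 1 / s" using real_state_le[OF f, of r] r(2) by simp
    then have "s * s * f r \<le> s * s * (1 / s)" by (intro mult_left_mono) auto
    then show ?thesis using s by simp
  qed
  moreover have "- f (q * q * r) \<le> norm (q * q) / s"
  proof -
    have "- f (q * q * r) \<le> norm (q * q * r)" using real_state_abs[OF f, of "q * q * r"] by simp
    also have "\<dots> \<le> norm (q * q) * norm r" by (rule norm_mult_ineq)
    also have "\<dots> \<le> norm (q * q) * (1 / s)" by (intro mult_left_mono r) simp
    finally show ?thesis by simp
  qed
  ultimately have "- f q \<le> norm (q * q) / s" by simp
  then have "- f q * s \<le> norm (q * q)" using s by (simp add: field_simps)
  then show False using neg by (simp add: s_def)
qed

text \<open>Near t the inverses have norm at most \<open>2 * norm (h t)\<close>, so the identity h u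
  - h t = h u (g t - g u) h t gives a local Lipschitz estimate in terms of \<open>g\<close>.\<close>

lemma continuous_on_inverses:
  fixes g h :: "'b::topological_space \<Rightarrow> 'a::{real_normed_algebra_1, banach}"
  assumes g: "continuous_on S g" and inv: "\<And>t. t \<in> S \<Longrightarrow> inverses (g t) (h t)"
  shows "continuous_on S h"
  unfolding continuous_on_def
proof
  fix t assume t: "t \<in> S"
  have g0: "((\<lambda>u. norm (g u - g t)) \<longlongrightarrow> 0) (at t within S)"
    using g t by (auto simp: continuous_on_def tendsto_norm_zero_iff LIM_zero_iff)
  then have "((\<lambda>u. norm (g u - g t) * norm (h t)) \<longlongrightarrow> 0 * norm (h t)) (at t within S)"
    by (intro tendsto_intros)
  then have "\<forall>\<^sub>F u in at t within S. norm (g u - g t) * norm (h t) < 1 / 2"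
    by (intro order_tendstoD(2)) auto
  moreover have "\<forall>\<^sub>F u in at t within S. u \<in> S"
    by (simp add: eventually_at_filter)
  ultimately have "\<forall>\<^sub>F u in at t within S. norm (h u - h t) \<le> 2 * norm (h t) * norm (h t) * norm (g u - g t)"
  proof eventually_elim
    case (elim u)
    obtain d where d: "inverses (g u) d" "norm d \<le> 2 * norm (h t)"
      using inverses_perturb[OF inv[OF t], of "g u"] elim by auto
    have hu: "h u = d" using inverses_unique[OF d(1)] inv[OF elim(2)] by (simp add: inverses_def)
    have "h u - h t = h u * (g t - g u) * h t"
      using inv[OF elim(2)] inv[OF t] by (simp add: inverses_def algebra_simps)
    then have "norm (h u - h t) \<le> norm (h u) * norm (g u - g t) * norm (h t)"
      using norm_mult3_ineq[of "h u" "g t - g u" "h t"] by (simp add: norm_minus_commute)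
    also have "\<dots> \<le> (2 * norm (h t)) * norm (g u - g t) * norm (h t)"
      unfolding hu by (intro mult_right_mono d) auto
    finally show ?case by (simp add: mult_ac)
  qed
  moreover have "((\<lambda>u. 2 * norm (h t) * norm (h t) * norm (g u - g t)) \<longlongrightarrow> 2 * norm (h t) * norm (h t) * 0) (at t within S)"
    by (intro tendsto_intros g0)
  ultimately have "((\<lambda>u. h u - h t) \<longlongrightarrow> 0) (at t within S)"
    using Lim_null_comparison[of "\<lambda>u. h u - h t"] by (simp only: mult_zero_right)
  then show "(h \<longlongrightarrow> h t) (at t within S)" by (simp add: LIM_zero_iff)
qed

section \<open>Complex Banach algebras with involution\<close>

lemma bounded_linear_continuous:
  fixes f :: "'a::real_normed_vector \<Rightarrow> 'b::real_normed_vector"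
  assumes f: "linear f" and cont: "continuous_on UNIV f"
  shows "bounded_linear f"
proof -
  have "isCont f 0" using cont by (simp add: continuous_on_eq_continuous_at)
  then obtain d where d: "d > 0" "\<And>x. norm x < d \<Longrightarrow> norm (f x) < 1"
    using linear_0[OF f] unfolding continuous_at_eps_delta dist_norm
    by (metis diff_zero zero_less_one)
  have "norm (f x) \<le> norm x * (2 / d)" for x
  proof (cases "x = 0")
    case False
    define c where "c = d / (2 * norm x)"
    have c: "c > 0" using d False by (simp add: c_def)
    have "norm (c *\<^sub>R x) < d" using d False by (simp add: c_def)
    then have "norm (f (c *\<^sub>R x)) < 1" by (rule d(2))
    then have "c * norm (f x) < 1" using c by (simp add: linear_scale[OF f])
    then show ?thesis using d(1) False by (simp add: c_def field_simps)
  qed (simp add: linear_0[OF f])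
  then show ?thesis
    using f by (intro bounded_linear_intro[of f "2 / d"]) (simp_all add: linear_add linear_scale)
qed

context unital_complex_banach_algebra
begin

lemma norm_i: "norm (\<i> *\<^sub>C a) = norm a"
  by (simp add: norm_scaleC)

lemma i_i: "\<i> *\<^sub>C (\<i> *\<^sub>C a) = - a"
  by (simp add: scale_scale)

lemma scaleC_scaleR: "c *\<^sub>C (r *\<^sub>R a) = r *\<^sub>R (c *\<^sub>C a)"
  by (simp add: scaleC_of_real[symmetric] scale_scale mult.commute)

lemma scaleC_eq: "c *\<^sub>C a = Re c *\<^sub>R a + Im c *\<^sub>R (\<i> *\<^sub>C a)"
proof -
  have "c *\<^sub>C a = (complex_of_real (Re c) + complex_of_real (Im c) * \<i>) *\<^sub>C a"
    by (subst complex_eq[of c]) (simp add: mult.commute)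
  then show ?thesis
    by (simp add: scale_left_distrib scaleC_of_real flip: scale_scale)
qed

lemma bounded_linear_scaleC: "bounded_linear (\<lambda>c. c *\<^sub>C a)"
  by (rule bounded_linear_intro[of _ "norm a"])
     (simp_all add: scale_left_distrib norm_scaleC scaleR_conv_of_real scaleC_of_real flip: scale_scale)

section \<open>Complex functionals and their real parts\<close>

definition complexify :: "('a \<Rightarrow> real) \<Rightarrow> 'a \<Rightarrow> complex"
  where "complexify f a = Complex (f a) (- f (\<i> *\<^sub>C a))"

lemma Re_complexify: "Re (complexify f a) = f a"
  by (simp add: complexify_def)

lemma complexify_add: "linear f \<Longrightarrow> complexify f (a + b) = complexify f a + complexify f b"
  by (simp add: complexify_def complex_eq_iff scale_right_distrib linear_add)

lemma complexify_scaleC: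
  assumes f: "linear f"
  shows "complexify f (c *\<^sub>C a) = c * complexify f a"
proof -
  have "f (c *\<^sub>C a) = Re c * f a + Im c * f (\<i> *\<^sub>C a)"
    by (subst scaleC_eq) (simp add: linear_add[OF f] linear_scale[OF f])
  moreover have "f (\<i> *\<^sub>C (c *\<^sub>C a)) = Re c * f (\<i> *\<^sub>C a) - Im c * f a"
  proof -
    have "\<i> *\<^sub>C (c *\<^sub>C a) = Re c *\<^sub>R (\<i> *\<^sub>C a) + Im c *\<^sub>R (- a)"
      by (subst scaleC_eq) (simp only: scale_right_distrib scaleC_scaleR i_i)
    then show ?thesis by (simp add: linear_add[OF f] linear_diff[OF f] linear_scale[OF f])
  qed
  ultimately show ?thesis by (simp add: complexify_def complex_eq_iff)
qed

text \<open>Multiplying \<open>a\<close> by a suitable scalar of modulus 1 makes the value real and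
  nonnegative, where it coincides with \<open>f\<close>.\<close>

lemma norm_complexify_le:
  assumes f: "linear f" and le: "\<And>a. f a \<le> norm a"
  shows "cmod (complexify f a) \<le> norm a"
proof (cases "complexify f a = 0")
  case False
  define c where "c = cnj (sgn (complexify f a))"
  have c: "cmod c = 1" using False by (simp add: c_def norm_sgn)
  have "c * complexify f a = cmod (complexify f a)"
    using False by (simp add: c_def complex_sgn_def scaleR_conv_of_real field_simps complex_norm_square[symmetric] power2_eq_square
        flip: of_real_mult)
  then have "cmod (complexify f a) = Re (complexify f (c *\<^sub>C a))"
    by (simp add: complexify_scaleC[OF f])
  also have "\<dots> \<le> norm (c *\<^sub>C a)" by (simp add: Re_complexify le)
  finally show ?thesis by (simp add: norm_scaleC c)
qed simp

lemma bounded_linear_complexify: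
  assumes f: "linear f" and le: "\<And>a. f a \<le> norm a"
  shows "bounded_linear (complexify f)"
  using complexify_scaleC[OF f] norm_complexify_le[OF assms]
  by (intro bounded_linear_intro[of _ 1] complexify_add[OF f])
     (simp_all add: scaleC_of_real[symmetric] scaleR_conv_of_real)

lemma state_complexify:
  assumes f: "real_state f"
  shows "continuous_linear_functional scaleC (complexify f)"
    and "complex_of_real (onorm (complexify f)) = complexify f 1"
    and "complexify f 1 = 1"
proof -
  note lin = real_state_linear[OF f] and le = real_state_le[OF f]
  note bl = bounded_linear_complexify[OF lin le]
  have "vector_space ((*) :: complex \<Rightarrow> complex \<Rightarrow> complex)"
    by unfold_locales (simp_all add: algebra_simps)
  then show "continuous_linear_functional scaleC (complexify f)"
    unfolding continuous_linear_functional_def Vector_Spaces.linear_iff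
    using vector_space_axioms complexify_add[OF lin] complexify_scaleC[OF lin]
      bounded_linear.continuous_on[OF bl continuous_on_id] by auto
  have re: "Re (complexify f 1) = 1" by (simp add: Re_complexify real_state_one[OF f])
  have "(cmod (complexify f 1))\<^sup>2 \<le> 1"
    using norm_complexify_le[OF lin le, of 1] by (simp add: power_le_one)
  then have "(Im (complexify f 1))\<^sup>2 \<le> 0" using re by (simp add: cmod_power2)
  then show one: "complexify f 1 = 1" using re by (simp add: complex_eq_iff)
  have "onorm (complexify f) \<le> 1"
    by (rule onorm_le) (simp add: norm_complexify_le[OF lin le])
  moreover have "1 \<le> onorm (complexify f)"
    using onorm[OF bl, of 1] one by simp
  ultimately show "complex_of_real (onorm (complexify f)) = complexify f 1"
    using one by simp
qed

lemma
  assumes \<omega>: "continuous_linear_functional scaleC \<omega>"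
  shows functional_scaleC: "\<omega> (c *\<^sub>C a) = c * \<omega> a"
    and bounded_linear_functional: "bounded_linear \<omega>"
proof -
  have add: "\<omega> (a + b) = \<omega> a + \<omega> b" and scale: "\<omega> (c *\<^sub>C a) = c * \<omega> a" for a b c
    using \<omega> by (auto simp: continuous_linear_functional_def Vector_Spaces.linear_iff)
  show "\<omega> (c *\<^sub>C a) = c * \<omega> a" by (rule scale)
  have "linear \<omega>"
    using scale by (intro linearI add) (simp add: scaleC_of_real[symmetric] scaleR_conv_of_real)
  then show "bounded_linear \<omega>"
    using \<omega> by (intro bounded_linear_continuous) (simp_all add: continuous_linear_functional_def)
qed

lemma state_of_functional:
  assumes \<omega>: "continuous_linear_functional scaleC \<omega>" "complex_of_real (onorm \<omega>) = \<omega> 1" "onorm \<omega> \<noteq> 0"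
  shows "real_state (\<lambda>a. Re (\<omega> a) / onorm \<omega>)"
proof -
  note bl = bounded_linear_functional[OF \<omega>(1)]
  note lin = bounded_linear.linear[OF bl]
  have pos: "onorm \<omega> > 0" using onorm_pos_le[OF bl] \<omega>(3) by simp
  have "Re (\<omega> a) \<le> onorm \<omega> * norm a" for a
    using onorm[OF bl, of a] complex_Re_le_cmod[of "\<omega> a"] by simp
  moreover have "linear (\<lambda>a. Re (\<omega> a) / onorm \<omega>)"
    by (rule linearI) (simp_all add: linear_add[OF lin] linear_scale[OF lin] add_divide_distrib)
  moreover have "Re (\<omega> 1) = onorm \<omega>" using \<omega>(2) by (metis Re_complex_of_real)
  ultimately show ?thesis
    using pos by (simp add: real_state_def field_simps)
qed

lemma norming_functional:
  obtains \<phi> where "bounded_linear \<phi>" "\<And>c a. \<phi> (c *\<^sub>C a) = c * \<phi> a" "\<And>a. cmod (\<phi> a) \<le> norm a"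
    "norm x \<le> cmod (\<phi> x)"
proof -
  have "sublinear (norm :: 'a \<Rightarrow> real)"
    by (simp add: sublinear_def norm_triangle_ineq)
  then obtain f where f: "linear f" "\<And>a. f a \<le> norm a" "f x = norm x"
    using Hahn_Banach_sublinear by blast
  show thesis
  proof (rule that[of "complexify f"])
    show "norm x \<le> cmod (complexify f x)"
      using complex_Re_le_cmod[of "complexify f x"] f(3) by (simp add: Re_complexify)
  qed (use f in \<open>simp_all add: bounded_linear_complexify complexify_scaleC norm_complexify_le\<close>)
qed

end

context unital_involutive_banach_algebra
begin

lemma star_zero: "star 0 = 0"
  using star_add[of 0 0] by simp

lemma star_minus: "star (- a) = - star a"
  using star_add[of a "- a"] by (simp add: star_zero eq_neg_iff_add_eq_0 add.commute)

lemma star_diff: "star (a - b) = star a - star b"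
  using star_add[of a "- b"] by (simp add: star_minus)

lemma star_one: "star 1 = 1"
  using star_mult[of "star 1" 1] star_star[of 1] by simp

lemma star_scaleR: "star (r *\<^sub>R a) = r *\<^sub>R star a"
  using star_scaleC[of "complex_of_real r" a] by (simp add: scaleC_of_real)

lemma star_i: "star (\<i> *\<^sub>C a) = - (\<i> *\<^sub>C star a)"
  by (simp add: star_scaleC)

lemma star_power: "star (a ^ n) = star a ^ n"
  by (induction n) (simp_all add: star_one star_mult power_commutes)

lemma star_sum: "star (sum f A) = (\<Sum>x\<in>A. star (f x))"
  by (induction A rule: infinite_finite_induct) (simp_all add: star_zero star_add)

lemmas star_simps = star_zero star_minus star_diff star_one star_scaleR star_scaleC star_add star_mult star_star

lemma inverses_star: "inverses a b \<Longrightarrow> inverses (star a) (star b)"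
  unfolding inverses_def by (metis star_mult star_one)

lemma inverses_selfadjoint: "inverses a b \<Longrightarrow> star a = a \<Longrightarrow> star b = b"
  using inverses_star[of a b] inverses_unique[of a b "star b"] by (simp add: inverses_def)

lemma star_binomial_series:
  assumes cont: "continuous_on UNIV star" and y: "summable (\<lambda>n. norm (y ^ n))" "star y = y"
    and \<alpha>: "\<bar>\<alpha>\<bar> \<le> 1"
  shows "star (binomial_series \<alpha> y) = binomial_series \<alpha> y"
proof -
  note sums = binomial_series_sums[OF y(1) \<alpha>]
  have "isCont star (binomial_series \<alpha> y)"
    using cont by (simp add: continuous_on_eq_continuous_at)
  then have "(\<lambda>n. star (\<Sum>i<n. (\<alpha> gchoose i) *\<^sub>R y ^ i)) \<longlonglongrightarrow> star (binomial_series \<alpha> y)"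
    using sums unfolding sums_def by (rule isCont_tendsto_compose)
  then have "(\<lambda>n. (\<alpha> gchoose n) *\<^sub>R y ^ n) sums star (binomial_series \<alpha> y)"
    by (simp add: sums_def star_sum star_scaleR star_power y(2))
  then show ?thesis using sums sums_unique2 by blast
qed

end

section \<open>Algebras whose self-adjoint elements have real numerical range\<close>

text \<open>Condition (2) in terms of real states: the second assumption says that
  \<open>complexify f\<close> is real at \<open>h\<close>. Every C*-algebra is an instance too, so
  the resolvent estimates below serve both directions of the equivalence.\<close>

locale hermitian_banach_algebra = unital_involutive_banach_algebra scaleC star
  for scaleC :: "complex \<Rightarrow> 'a::{real_normed_algebra_1, banach} \<Rightarrow> 'a" (infixr \<open>*\<^sub>C\<close> 75)
    and star :: "'a \<Rightarrow> 'a" +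
  assumes star_continuous: "continuous_on UNIV star"
    and state_i_selfadjoint: "real_state f \<Longrightarrow> star h = h \<Longrightarrow> f (\<i> *\<^sub>C h) = 0"
begin

lemma resolvent_i:
  assumes k: "star k = k" and s: "s > 0"
  obtains r where "inverses (s *\<^sub>R 1 - \<i> *\<^sub>C k) r" "norm r \<le> 1 / s"
proof -
  have "\<forall>f. real_state f \<longrightarrow> f (\<i> *\<^sub>C k) \<le> 0"
    using state_i_selfadjoint[OF _ k] by (metis order_refl)
  from state_bound_resolvent[OF this s] show thesis using that by auto
qed

lemma resolvent_i_one:
  assumes k: "star k = k" and r: "inverses (1 - \<i> *\<^sub>C k) r"
  shows "norm r \<le> 1"
proof -
  obtain r' where "inverses (1 *\<^sub>R 1 - \<i> *\<^sub>C k) r'" "norm r' \<le> 1 / 1"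
    using resolvent_i[OF k, of 1] by auto
  then show ?thesis using inverses_unique[of "1 - \<i> *\<^sub>C k" r' r] r by (simp add: inverses_def)
qed

text \<open>With r the inverse of 1 - i k, one has 1 + i k = r (1 + k^2) and
  \<open>norm r \<le> 1\<close>. The triangle inequality alone would leave a term linear in
  \<open>norm k\<close>, which would not disappear under subdivision.\<close>

lemma norm_one_plus_i:
  assumes k: "star k = k"
  shows "norm (1 + \<i> *\<^sub>C k) \<le> 1 + (norm k)\<^sup>2"
proof -
  obtain r where r: "inverses (1 - \<i> *\<^sub>C k) r" "norm r \<le> 1"
    using resolvent_i[OF k, of 1] by auto
  have "(1 - \<i> *\<^sub>C k) * (1 + \<i> *\<^sub>C k) = 1 - \<i> *\<^sub>C k * (\<i> *\<^sub>C k)"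
    by (simp add: algebra_simps)
  then have "r * ((1 - \<i> *\<^sub>C k) * (1 + \<i> *\<^sub>C k)) = r - r * (\<i> *\<^sub>C k) * (\<i> *\<^sub>C k)"
    by (simp add: right_diff_distrib mult.assoc del: mult_scaleC_left mult_scaleC_right)
  then have "1 + \<i> *\<^sub>C k = r - r * (\<i> *\<^sub>C k) * (\<i> *\<^sub>C k)"
    by (simp only: inverses_right[OF r(1)])
  then have "norm (1 + \<i> *\<^sub>C k) \<le> norm r + norm (r * (\<i> *\<^sub>C k) * (\<i> *\<^sub>C k))"
    by (simp only: norm_triangle_ineq4)
  also have "norm (r * (\<i> *\<^sub>C k) * (\<i> *\<^sub>C k)) \<le> norm r * norm k * norm k"
    using norm_mult3_ineq[of r "\<i> *\<^sub>C k" "\<i> *\<^sub>C k"] by (simp only: norm_i)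
  also have "norm r * norm k * norm k \<le> 1 * norm k * norm k"
    using r(2) by (intro mult_right_mono) auto
  finally show ?thesis using r(2) by (simp add: power2_eq_square)
qed

subsection \<open>Unitary elements have norm at most one\<close>

text \<open>A unitary \<open>w = u v\<^sup>*\<close> close to \<open>1\<close> agrees to second order with \<open>1 + i k\<close>, \<open>k\<close> self-adjoint.\<close>

lemma norm_unitary_near:
  assumes u: "inverses u (star u)" and v: "inverses v (star v)"
    and d: "norm (u * star v - 1) \<le> d" "norm (v * star u - 1) \<le> d"
  shows "norm u \<le> (1 + 2 * d\<^sup>2) * norm v"
proof -
  define w where "w = u * star v"
  have sw: "star w = v * star u" by (simp add: w_def star_simps)
  have ww: "w * star w = 1"
    using inverses_right[OF v, of "star u"] u by (simp add: w_def star_simps mult.assoc inverses_def)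
  define k where "k = - ((1/2) *\<^sub>R (\<i> *\<^sub>C (w - star w)))"
  have k: "star k = k"
    by (simp add: k_def star_simps scale_right_diff_distrib algebra_simps)
  have ik: "\<i> *\<^sub>C k = (1/2) *\<^sub>R (w - star w)"
    unfolding k_def by (simp only: scale_minus_right scaleC_scaleR i_i scaleR_minus_right minus_minus)
  have d0: "0 \<le> d" using d(1) norm_ge_zero order_trans by blast
  have dw: "norm (w - 1) \<le> d" "norm (star w - 1) \<le> d"
    using d by (simp_all add: w_def star_simps)
  then have "norm (w - star w) \<le> 2 * d"
    using norm_triangle_ineq4[of "w - 1" "star w - 1"] by simp
  then have "norm (\<i> *\<^sub>C k) \<le> d" unfolding ik by simp
  then have nk: "norm k \<le> d" by (simp only: norm_i)
  \<comment> \<open>Since \<open>w * star w = 1\<close>, this product is exactly the second-order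
    remainder (1 + i k) - w.\<close>
  have "(1/2) *\<^sub>R ((w - 1) * (star w - 1)) = 1 - (1/2) *\<^sub>R w - (1/2) *\<^sub>R star w"
    by (simp add: left_diff_distrib right_diff_distrib ww scaleR_right_diff_distrib)
       (simp add: algebra_simps flip: scaleR_add_left)
  then have "w = (1 + \<i> *\<^sub>C k) - (1/2) *\<^sub>R ((w - 1) * (star w - 1))"
    unfolding ik by (simp add: algebra_simps flip: scaleR_add_left)
  then have "norm w \<le> norm (1 + \<i> *\<^sub>C k) + norm ((1/2) *\<^sub>R ((w - 1) * (star w - 1)))"
    by (metis norm_triangle_ineq4)
  also have "norm ((1/2) *\<^sub>R ((w - 1) * (star w - 1))) \<le> d * d"
  proof -
    have "norm ((w - 1) * (star w - 1)) \<le> norm (w - 1) * norm (star w - 1)" by (rule norm_mult_ineq)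
    also have "\<dots> \<le> d * d" using dw d0 by (intro mult_mono) auto
    finally have "norm ((w - 1) * (star w - 1)) \<le> d * d" .
    moreover have "0 \<le> d * d" by simp
    ultimately have "norm ((w - 1) * (star w - 1)) / 2 \<le> d * d" by linarith
    then show ?thesis by simp
  qed
  also have "norm (1 + \<i> *\<^sub>C k) \<le> 1 + d\<^sup>2"
    using norm_one_plus_i[OF k] power_mono[OF nk, of 2] by simp
  finally have w: "norm w \<le> 1 + 2 * d\<^sup>2" by (simp add: power2_eq_square)
  have "u = w * v" using v by (simp add: w_def inverses_def mult.assoc)
  then have "norm u \<le> norm w * norm v" by (simp add: norm_mult_ineq)
  also have "\<dots> \<le> (1 + 2 * d\<^sup>2) * norm v" by (intro mult_right_mono w) simp
  finally show ?thesis .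
qed

text \<open>The Cayley transforms of \<open>t k\<close>, \<open>0 \<le> t \<le> 1\<close>, join \<open>1\<close> to \<open>u\<close>; with \<open>n\<close> equal steps,
  \<open>norm_unitary_near\<close> gives \<open>norm u \<le> (1 + C / n\<^sup>2) ^ n\<close>.\<close>

lemma norm_cayley_le_one:
  assumes k: "star k = k" and r: "inverses (1 - \<i> *\<^sub>C k) r"
  shows "norm ((1 + \<i> *\<^sub>C k) * r) \<le> 1"
proof -
  have "\<exists>r. inverses (1 - t *\<^sub>R (\<i> *\<^sub>C k)) r" for t
  proof -
    have "star (t *\<^sub>R k) = t *\<^sub>R k" by (simp add: star_simps k)
    from resolvent_i[OF this, of 1] show ?thesis by (auto simp: scaleC_scaleR)
  qed
  then obtain R where R: "\<And>t. inverses (1 - t *\<^sub>R (\<i> *\<^sub>C k)) (R t)" by metis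
  have nR: "norm (R t) \<le> 1" for t
    using resolvent_i_one[of "t *\<^sub>R k" "R t"] R[of t] by (simp add: star_simps k scaleC_scaleR)
  have sR: "inverses (1 + t *\<^sub>R (\<i> *\<^sub>C k)) (star (R t))" for t
    using inverses_star[OF R[of t]] by (simp add: star_simps star_i k)
  have nsR: "norm (star (R t)) \<le> 1" for t
    using resolvent_i_one[of "- (t *\<^sub>R k)" "star (R t)"] sR[of t]
    by (simp add: star_simps k scaleC_scaleR)
  define u where "u = (\<lambda>t. (1 + t *\<^sub>R (\<i> *\<^sub>C k)) * R t)"
  have u_eq: "u t = 2 *\<^sub>R R t - 1" for t
  proof -
    have "1 + t *\<^sub>R (\<i> *\<^sub>C k) = 2 *\<^sub>R 1 - (1 - t *\<^sub>R (\<i> *\<^sub>C k))" by (simp add: scaleR_2)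
    then have "u t = 2 *\<^sub>R R t - (1 - t *\<^sub>R (\<i> *\<^sub>C k)) * R t"
      unfolding u_def by (simp only: left_diff_distrib mult_scaleR_left mult_1_left)
    then show ?thesis using R[of t] by (simp add: inverses_def)
  qed
  have star_u: "star (u t) = 2 *\<^sub>R star (R t) - 1" for t
    by (simp add: u_eq star_simps)
  have nsu: "norm (star (u t)) \<le> 3" for t
    using norm_triangle_ineq4[of "2 *\<^sub>R star (R t)" 1] nsR[of t] unfolding star_u by simp
  have unitary: "inverses (u t) (star (u t))" for t
  proof -
    have "inverses (u t) ((1 - t *\<^sub>R (\<i> *\<^sub>C k)) * star (R t))"
      unfolding u_def using inverses_mult[OF sR[of t] inverses_sym[OF R[of t]]] .
    moreover have "star (R t) * (1 - t *\<^sub>R (\<i> *\<^sub>C k)) = (1 - t *\<^sub>R (\<i> *\<^sub>C k)) * star (R t)"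
      by (rule inverses_commute[OF sR[of t]]) (simp add: algebra_simps)
    moreover have "star (u t) = star (R t) * (1 - t *\<^sub>R (\<i> *\<^sub>C k))"
      by (simp add: u_def star_simps star_i k)
    ultimately show ?thesis by simp
  qed
  have lip: "norm (u t * star (u s) - 1) \<le> 6 * \<bar>t - s\<bar> * norm k" for s t
  proof -
    have "R t - R s = R t * ((t - s) *\<^sub>R (\<i> *\<^sub>C k)) * R s"
    proof -
      have "(t - s) *\<^sub>R (\<i> *\<^sub>C k) = (1 - s *\<^sub>R (\<i> *\<^sub>C k)) - (1 - t *\<^sub>R (\<i> *\<^sub>C k))"
        by (simp add: scaleR_left_diff_distrib)
      then have "R t * ((t - s) *\<^sub>R (\<i> *\<^sub>C k)) * R s
          = R t * ((1 - s *\<^sub>R (\<i> *\<^sub>C k)) * R s) - (R t * (1 - t *\<^sub>R (\<i> *\<^sub>C k))) * R s"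
        by (simp only: right_diff_distrib left_diff_distrib mult.assoc)
      then show ?thesis using R[of t] R[of s] by (simp add: inverses_def)
    qed
    then have "norm (R t - R s) \<le> norm (R t) * norm ((t - s) *\<^sub>R (\<i> *\<^sub>C k)) * norm (R s)"
      by (simp only: norm_mult3_ineq)
    also have "\<dots> \<le> 1 * norm ((t - s) *\<^sub>R (\<i> *\<^sub>C k)) * 1"
      using nR by (intro mult_mono) auto
    finally have "norm (R t - R s) \<le> \<bar>t - s\<bar> * norm k" by (simp add: norm_scaleC)
    then have "norm (u t - u s) \<le> 2 * (\<bar>t - s\<bar> * norm k)"
      by (simp add: u_eq flip: scaleR_right_diff_distrib)
    then have "norm (u t - u s) * norm (star (u s)) \<le> 2 * (\<bar>t - s\<bar> * norm k) * 3"
      using nsu by (intro mult_mono) auto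
    moreover have "u t * star (u s) - 1 = (u t - u s) * star (u s)"
      using unitary[of s] by (simp add: inverses_def left_diff_distrib)
    ultimately show ?thesis using norm_mult_ineq[of "u t - u s" "star (u s)"] by (simp add: mult_ac)
  qed
  have u0: "u 0 = 1" using R[of 0] by (simp add: u_def inverses_def)
  \<comment> \<open>The factor 6 is the Lipschitz constant in \<open>lip\<close>: 2 from u = 2 R -
    1, and 3 from the bound on \<open>star (u s)\<close>. Steps of length 1/n thus give d = 6 * norm
    k / n.\<close>
  define C where "C = 2 * (6 * norm k)\<^sup>2"
  have C: "C \<ge> 0" by (simp add: C_def)
  have bound: "norm (u 1) \<le> exp (C / real n)" if n: "n > 0" for n
  proof -
    have "norm (u (real j / n)) \<le> (1 + C / n\<^sup>2) ^ j" for j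
    proof (induction j)
      case (Suc j)
      let ?d = "6 * (1 / n) * norm k"
      have "\<bar>real (Suc j) / n - real j / n\<bar> = 1 / n"
        using n by (simp add: field_simps)
      moreover have "\<bar>real j / n - real (Suc j) / n\<bar> = 1 / n"
        using n by (simp add: field_simps)
      ultimately have "norm (u (real (Suc j) / n)) \<le> (1 + 2 * ?d\<^sup>2) * norm (u (real j / n))"
        using lip[of "real (Suc j) / n" "real j / n"] lip[of "real j / n" "real (Suc j) / n"]
        by (intro norm_unitary_near unitary) (simp_all only:)
      also have "2 * ?d\<^sup>2 = C / n\<^sup>2" by (simp add: C_def power_mult_distrib power_divide)
      also have "(1 + C / n\<^sup>2) * norm (u (real j / n)) \<le> (1 + C / n\<^sup>2) * (1 + C / n\<^sup>2) ^ j"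
        using C by (intro mult_left_mono Suc) auto
      finally show ?case by simp
    qed (simp add: u0)
    from this[of n] have "norm (u 1) \<le> (1 + C / n\<^sup>2) ^ n" using n by simp
    also have "\<dots> \<le> exp (C / n\<^sup>2) ^ n"
      using C by (intro power_mono) auto
    also have "\<dots> = exp (C / n)"
      using n by (simp add: exp_of_nat_mult[symmetric] power2_eq_square)
    finally show ?thesis .
  qed
  have "(\<lambda>n. exp (C / real n)) \<longlonglongrightarrow> exp 0"
    by (intro tendsto_intros lim_const_over_n)
  then have "norm (u 1) \<le> exp 0"
    by (rule LIMSEQ_le_const) (use bound in \<open>auto intro!: exI[of _ 1]\<close>)
  moreover have "R 1 = r" using inverses_unique[OF r, of "R 1"] R[of 1] by (simp add: inverses_def)
  ultimately show ?thesis by (simp add: u_def)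
qed

text \<open>Such a \<open>u\<close> is the Cayley transform of k = - i (u - 1) (u + 1)^-1; the
  inverse exists because 1 + u is at distance less than 1 from 2. Self-adjointness of
  \<open>k\<close> follows from \<open>star r = r * u\<close>.\<close>

lemma norm_unitary_near_one:
  assumes u: "inverses u (star u)" and near: "norm (u - 1) < 1"
  shows "norm u \<le> 1"
proof -
  have "inverses (2 *\<^sub>R 1) ((1/2) *\<^sub>R (1::'a))" by (simp add: inverses_def)
  moreover have "1 + u - 2 *\<^sub>R 1 = u - 1" by (simp add: scaleR_2)
  with near have "norm (1 + u - 2 *\<^sub>R 1) * norm ((1/2) *\<^sub>R (1::'a)) \<le> 1 / 2" by (simp only:) simp
  ultimately obtain r where r: "inverses (1 + u) r" using inverses_perturb by blast
  have comm: "r * u = u * r" using inverses_commute[OF r, of u] by (simp add: algebra_simps)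
  have "star (1 + u) = star u * (1 + u)"
    using u by (simp add: star_simps inverses_def distrib_left)
  then have "inverses (star u * (1 + u)) (star r)" using inverses_star[OF r] by simp
  moreover have "inverses (star u * (1 + u)) (r * u)"
    using inverses_mult[OF inverses_sym[OF u] r] .
  ultimately have star_r: "star r = r * u"
    using inverses_unique[of "star u * (1 + u)" "r * u" "star r"] by (simp add: inverses_def)
  define k where "k = - (\<i> *\<^sub>C ((u - 1) * r))"
  have ik: "\<i> *\<^sub>C k = (u - 1) * r" by (simp only: k_def scale_minus_right i_i minus_minus)
  have "star ((u - 1) * r) = r * u * (star u - 1)" by (simp add: star_simps star_r)
  also have "\<dots> = r * (1 - u)" using u by (simp add: inverses_def right_diff_distrib mult.assoc)
  also have "\<dots> = - ((u - 1) * r)" using comm by (simp add: algebra_simps)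
  finally have k: "star k = k" by (simp add: k_def star_minus star_i)
  have ur: "u * r = 1 - r" using r by (simp add: inverses_def algebra_simps eq_diff_eq)
  have minus: "1 - \<i> *\<^sub>C k = 2 *\<^sub>R r" unfolding ik by (simp add: left_diff_distrib ur scaleR_2)
  have plus: "1 + \<i> *\<^sub>C k = 2 *\<^sub>R (u * r)" unfolding ik by (simp add: left_diff_distrib ur scaleR_right_diff_distrib scaleR_2)
  have "inverses (1 - \<i> *\<^sub>C k) ((1/2) *\<^sub>R (1 + u))"
    using inverses_scaleR[OF inverses_sym[OF r], of 2] unfolding minus by simp
  from norm_cayley_le_one[OF k this] show ?thesis
    unfolding plus using r by (simp add: inverses_def mult.assoc comm)
qed

text \<open>Along a fine subdivision each quotient \<open>u t * star (u s)\<close> is a unitary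
  close to 1, so the norm does not increase from node to node. Compactness provides the bound on
  \<open>star (u s)\<close> that makes the closeness uniform.\<close>

lemma norm_unitary_path:
  assumes cont: "continuous_on {0..1::real} u"
    and u: "\<And>t. t \<in> {0..1} \<Longrightarrow> inverses (u t) (star (u t))"
    and start: "norm (u 0) \<le> 1"
  shows "norm (u 1) \<le> 1"
proof -
  have "continuous_on {0..1} (\<lambda>t. star (u t))"
    by (rule continuous_on_compose2[OF star_continuous cont]) auto
  then have "bounded ((\<lambda>t. star (u t)) ` {0..1})"
    by (intro compact_imp_bounded compact_continuous_image) auto
  then obtain B where B: "B > 0" "\<And>t. t \<in> {0..1} \<Longrightarrow> norm (star (u t)) \<le> B"
    unfolding bounded_pos by blast
  have "uniformly_continuous_on {0..1} u"
    using cont compact_uniformly_continuous by blast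
  then obtain e where e: "e > 0"
    "\<And>s t. s \<in> {0..1} \<Longrightarrow> t \<in> {0..1} \<Longrightarrow> dist t s < e \<Longrightarrow> dist (u t) (u s) < 1 / B"
    using B(1) unfolding uniformly_continuous_on_def by (metis zero_less_divide_1_iff)
  have step: "norm (u t) \<le> norm (u s)" if st: "s \<in> {0..1}" "t \<in> {0..1}" "dist t s < e" for s t
  proof -
    have "u t * star (u s) - 1 = (u t - u s) * star (u s)"
      using u[OF st(1)] by (simp add: inverses_def left_diff_distrib)
    then have "norm (u t * star (u s) - 1) \<le> norm (u t - u s) * norm (star (u s))"
      by (simp only: norm_mult_ineq)
    also have "\<dots> \<le> norm (u t - u s) * B" using B st by (intro mult_left_mono) auto
    also have "\<dots> < 1" using e(2)[OF st] B(1) by (simp add: dist_norm field_simps)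
    finally have "norm (u t * star (u s)) \<le> 1"
      using inverses_mult[OF u[OF st(2)] inverses_sym[OF u[OF st(1)]]]
      by (intro norm_unitary_near_one) (simp_all add: star_simps)
    moreover have "u t = u t * star (u s) * u s"
      using u[OF st(1)] by (simp add: inverses_def mult.assoc)
    then have "norm (u t) \<le> norm (u t * star (u s)) * norm (u s)"
      by (metis norm_mult_ineq)
    ultimately show ?thesis
      using mult_right_mono[of "norm (u t * star (u s))" 1 "norm (u s)"] by simp
  qed
  obtain n :: nat where n: "n > 0" "1 / real n < e"
    using e(1) by (metis inverse_eq_divide reals_Archimedean zero_less_Suc)
  have "norm (u (real j / n)) \<le> 1" if "j \<le> n" for j
    using that
  proof (induction j)
    case (Suc j)
    have "norm (u (real (Suc j) / n)) \<le> norm (u (real j / n))"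
    proof (rule step)
      have "real (Suc j) / n - real j / n = 1 / n" by (simp add: add_divide_distrib)
      then show "dist (real (Suc j) / n) (real j / n) < e" using n by (simp add: dist_real_def)
    qed (use Suc.prems n in \<open>auto simp: divide_le_eq\<close>)
    then show ?case using Suc by simp
  qed (simp add: start)
  from this[of n] n show ?thesis by simp
qed

subsection \<open>The norm is a \<open>C\<^sup>*\<close>-norm\<close>

text \<open>Ptak's factorisation \<open>(1 + x\<^sup>*) (1 - x) = a\<^sup>2 + (x\<^sup>* - x) = a (1 - i k) a\<close> with \<open>a\<^sup>2 = 1 - x\<^sup>* x\<close>
  and \<open>k\<close> self-adjoint.\<close>

lemma ptak_factor:
  assumes y: "summable (\<lambda>n. norm (y ^ n))" "star y = y" and z: "star z = - z"
  obtains r where "inverses (1 - y - z) r"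
proof -
  let ?a = "binomial_series (1/2) (- y)" and ?a' = "binomial_series (- (1/2)) (- y)"
  note sm = summable_norm_power_minus[OF y(1)]
  have inv: "inverses ?a ?a'" by (rule binomial_series_neg_inverses[OF sm]) simp
  have sa': "star ?a' = ?a'"
    by (rule star_binomial_series[OF star_continuous sm]) (simp_all add: star_minus y(2))
  define k where "k = - (\<i> *\<^sub>C (?a' * z * ?a'))"
  have ik: "\<i> *\<^sub>C k = ?a' * z * ?a'" by (simp only: k_def scale_minus_right i_i minus_minus)
  have "star (?a' * z * ?a') = - (?a' * z * ?a')"
    by (simp only: star_mult sa' z) (simp add: mult.assoc)
  then have "star k = k" by (simp add: k_def star_minus star_i)
  then obtain r where r: "inverses (1 - \<i> *\<^sub>C k) r"
    using resolvent_i[of k 1] by auto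
  have "?a * (1 - \<i> *\<^sub>C k) * ?a = ?a * ?a - ?a * (?a' * z * ?a') * ?a"
    unfolding ik by (simp add: left_diff_distrib right_diff_distrib)
  also have "?a * (?a' * z * ?a') * ?a = z"
    using inv by (simp add: mult.assoc inverses_left[OF inv]) (simp add: inverses_def)
  also have "?a * ?a = 1 - y" by (simp add: binomial_series_half[OF sm])
  finally have eq: "?a * (1 - \<i> *\<^sub>C k) * ?a = 1 - y - z" .
  show thesis
    using inverses_mult[OF inverses_mult[OF inv r] inv] that unfolding eq by blast
qed

text \<open>Multiplying 1 - x by 1 + star x on the left yields only a left inverse. The product in
  the other order involves \<open>x * star x\<close>, whose powers are also summable, and yields a
  right inverse.\<close>

lemma one_minus_invertible:
  assumes x: "summable (\<lambda>n. norm ((star x * x) ^ n))"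
  obtains r where "inverses (1 - x) r"
proof -
  obtain r where r: "inverses (1 - star x * x - (x - star x)) r"
    using ptak_factor[OF x, of "x - star x"] by (auto simp: star_simps)
  obtain s where s: "inverses (1 - x * star x - (x - star x)) s"
    using ptak_factor[OF summable_norm_power_swap[OF x], of "x - star x"] by (auto simp: star_simps)
  have 1: "(1 + star x) * (1 - x) = 1 - star x * x - (x - star x)"
    and 2: "(1 - x) * (1 + star x) = 1 - x * star x - (x - star x)"
    by (simp_all add: algebra_simps)
  have "(r * (1 + star x)) * (1 - x) = 1"
    using r unfolding inverses_def mult.assoc 1 by simp
  moreover have "(1 - x) * ((1 + star x) * s) = 1"
    using s unfolding inverses_def mult.assoc[symmetric] 2 by simp
  ultimately show thesis using left_right_inverses that by blast
qed

lemma one_plus_scaleC_star_invertible: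
  assumes x: "summable (\<lambda>n. norm ((star x * x) ^ n))" and l: "cmod l \<le> 1"
  obtains r where "inverses (1 + l *\<^sub>C star x) r"
proof -
  let ?z = "- (l *\<^sub>C star x)"
  have "star ?z * ?z = (l * cnj l) *\<^sub>C (x * star x)"
    by (simp add: star_simps mult_scaleC_left mult_scaleC_right scale_scale mult.commute)
  also have "\<dots> = (cmod l)\<^sup>2 *\<^sub>R (x * star x)"
    by (simp add: complex_norm_square[symmetric] scaleC_of_real flip: of_real_power)
  finally have "star ?z * ?z = (cmod l)\<^sup>2 *\<^sub>R (x * star x)" .
  moreover have "summable (\<lambda>n. norm (((cmod l)\<^sup>2 *\<^sub>R (x * star x)) ^ n))"
    using l by (intro summable_norm_power_scaleR summable_norm_power_swap[OF x]) (simp add: power_le_one)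
  ultimately obtain r where "inverses (1 - ?z) r"
    using one_minus_invertible[of ?z] by auto
  then show thesis using that by simp
qed

text \<open>The relations \<open>x * Q = P * x\<close> and \<open>Q * star x = star x * P\<close>
  reduce \<open>star u * u = 1\<close> to the identity \<open>key\<close>. Invertibility of
  \<open>u\<close> is read off its factors, because x + l = l (1 + cnj l x); hence the left inverse
  \<open>star u\<close> is the inverse.\<close>

lemma moebius_unitary:
  assumes a: "inverses a a'" "star a = a" "a * a = 1 - star x * x"
    and b: "inverses b b'" "star b = b" "b * b = 1 - x * star x"
    and R: "inverses (1 + l *\<^sub>C star x) R" and l: "cmod l = 1"
  defines "u \<equiv> b' * (x + l *\<^sub>C 1) * R * a"
  shows "inverses u (star u)"
proof -
  define P where "P = b' * b'"
  define Q where "Q = a' * a'"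
  have P: "inverses (1 - x * star x) P"
    using inverses_mult[OF b(1) b(1)] by (simp add: b(3) P_def)
  have Q: "inverses (1 - star x * x) Q"
    using inverses_mult[OF a(1) a(1)] by (simp add: a(3) Q_def)
  have xQ: "x * Q = P * x"
    by (rule inverses_intertwine[OF Q P, symmetric]) (simp add: algebra_simps)
  have Qx: "Q * star x = star x * P"
    by (rule inverses_intertwine[OF P Q]) (simp add: algebra_simps)
  have "P - x * (star x * P) = 1" "Q - star x * (x * Q) = 1"
    using P Q by (simp_all add: inverses_def left_diff_distrib mult.assoc)
  then have P1: "x * (star x * P) = P - 1" and Q1: "star x * (x * Q) = Q - 1"
    by (simp_all add: algebra_simps)
  have ll: "l * cnj l = 1" using l by (simp add: complex_norm_square[symmetric])
  have sR: "inverses (1 + cnj l *\<^sub>C x) (star R)"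
    using inverses_star[OF R] by (simp add: star_simps)
  have b': "star b' = b'" using inverses_selfadjoint[OF b(1,2)] .
  have "inverses (l *\<^sub>C (1 + cnj l *\<^sub>C x)) (cnj l *\<^sub>C star R)"
    using sR ll by (simp add: inverses_def mult_scaleC_left mult_scaleC_right scale_scale mult.commute)
  moreover have "l *\<^sub>C (1 + cnj l *\<^sub>C x) = x + l *\<^sub>C 1"
    by (simp add: scale_right_distrib scale_scale ll)
  ultimately have "inverses (x + l *\<^sub>C 1) (cnj l *\<^sub>C star R)" by simp
  from inverses_mult[OF inverses_mult[OF inverses_mult[OF inverses_sym[OF b(1)] this] inverses_sym[OF R]] a(1)]
  obtain v where v: "inverses u v" unfolding u_def by blast
  have key: "(star x + cnj l *\<^sub>C 1) * P * (x + l *\<^sub>C 1) = (1 + cnj l *\<^sub>C x) * Q * (1 + l *\<^sub>C star x)"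
  proof -
    have "(star x + cnj l *\<^sub>C 1) * P * (x + l *\<^sub>C 1)
        = star x * (P * x) + l *\<^sub>C (star x * P) + cnj l *\<^sub>C (P * x) + P"
      using ll by (simp add: distrib_left distrib_right mult_scaleC_left mult_scaleC_right scale_scale
          scale_right_distrib mult.commute mult.assoc add_ac)
    also have "\<dots> = Q + l *\<^sub>C (Q * star x) + cnj l *\<^sub>C (x * Q) + x * (Q * star x)"
      by (simp add: xQ[symmetric] Qx Q1 P1)
    also have "\<dots> = (1 + cnj l *\<^sub>C x) * Q * (1 + l *\<^sub>C star x)"
      using ll by (simp add: distrib_left distrib_right mult_scaleC_left mult_scaleC_right scale_scale
          scale_right_distrib mult.commute mult.assoc add_ac)
    finally show ?thesis .
  qed
  have "star u * u = a * (star R * ((star x + cnj l *\<^sub>C 1) * P * (x + l *\<^sub>C 1)) * R) * a"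
    by (simp add: u_def star_simps a(2) b' P_def mult.assoc)
  also have "\<dots> = a * ((star R * (1 + cnj l *\<^sub>C x)) * Q * ((1 + l *\<^sub>C star x) * R)) * a"
    unfolding key by (simp only: mult.assoc)
  also have "\<dots> = a * Q * a" using R sR by (simp add: inverses_def)
  also have "\<dots> = 1" using a(1) by (simp add: Q_def inverses_def flip: mult.assoc)
  finally have "star u = v" using inverses_unique[OF v] by blast
  then show ?thesis using v by simp
qed

text \<open>Replacing \<open>x\<close> by \<open>t x\<close>, \<open>0 \<le> t \<le> 1\<close>, gives a path of unitaries from the scalar \<open>l\<close>.\<close>

lemma norm_moebius_le_one:
  assumes x: "summable (\<lambda>n. norm ((star x * x) ^ n))"
    and R: "inverses (1 + l *\<^sub>C star x) R" and l: "cmod l = 1"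
  shows "norm (binomial_series (- (1/2)) (- (x * star x)) * (x + l *\<^sub>C 1) * R *
    binomial_series (1/2) (- (star x * x))) \<le> 1"
proof -
  note x' = summable_norm_power_swap[OF x]
  have sq: "\<bar>t\<^sup>2\<bar> \<le> 1" if "t \<in> {0..1}" for t :: real
    using that by (simp add: power_le_one)
  have sm1: "summable (\<lambda>n. norm ((t\<^sup>2 *\<^sub>R - (star x * x)) ^ n))"
    and sm2: "summable (\<lambda>n. norm ((t\<^sup>2 *\<^sub>R - (x * star x)) ^ n))" if "t \<in> {0..1}" for t :: real
    by (rule summable_norm_power_scaleR[OF summable_norm_power_minus sq[OF that]]; fact)+
  have "\<exists>r. inverses (1 + l *\<^sub>C (t *\<^sub>R star x)) r" if "t \<in> {0..1}" for t
  proof -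
    have "star (t *\<^sub>R x) * (t *\<^sub>R x) = t\<^sup>2 *\<^sub>R (star x * x)"
      by (simp add: star_simps power2_eq_square)
    moreover have "summable (\<lambda>n. norm ((t\<^sup>2 *\<^sub>R (star x * x)) ^ n))"
      by (rule summable_norm_power_scaleR[OF x sq[OF that]])
    ultimately have "summable (\<lambda>n. norm ((star (t *\<^sub>R x) * (t *\<^sub>R x)) ^ n))" by (simp only:)
    then obtain r where "inverses (1 + l *\<^sub>C star (t *\<^sub>R x)) r"
      using one_plus_scaleC_star_invertible[of "t *\<^sub>R x" l] l by auto
    then show ?thesis by (auto simp: star_scaleR)
  qed
  then obtain r where r: "\<And>t. t \<in> {0..1} \<Longrightarrow> inverses (1 + l *\<^sub>C (t *\<^sub>R star x)) (r t)" by metis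
  define a where "a = (\<lambda>\<alpha> t::real. binomial_series \<alpha> (t\<^sup>2 *\<^sub>R - (star x * x)))"
  define b where "b = (\<lambda>\<alpha> t::real. binomial_series \<alpha> (t\<^sup>2 *\<^sub>R - (x * star x)))"
  define u where "u = (\<lambda>t. b (- (1/2)) t * (t *\<^sub>R x + l *\<^sub>C 1) * r t * a (1/2) t)"
  have "norm (u 1) \<le> 1"
  proof (rule norm_unitary_path)
    have sub: "(\<lambda>t::real. t\<^sup>2) ` {0..1} \<subseteq> {-1..1}"
      using sq unfolding abs_le_iff by (fastforce simp: minus_le_iff)
    have "continuous_on {0..1} (b (- (1/2)))" unfolding b_def
      by (rule continuous_on_compose2[OF continuous_on_binomial_series[OF summable_norm_power_minus[OF x']] _ sub])
         (auto intro!: continuous_intros)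
    moreover have "continuous_on {0..1} (a (1/2))" unfolding a_def
      by (rule continuous_on_compose2[OF continuous_on_binomial_series[OF summable_norm_power_minus[OF x]] _ sub])
         (auto intro!: continuous_intros)
    moreover have "continuous_on {0..1} r"
      by (rule continuous_on_inverses[OF _ r]) (simp_all add: scaleC_scaleR continuous_intros)
    ultimately show "continuous_on {0..1} u"
      unfolding u_def by (intro continuous_intros) simp_all
  next
    fix t :: real assume t: "t \<in> {0..1}"
    show "inverses (u t) (star (u t))"
      unfolding u_def
    proof (rule moebius_unitary)
      show "inverses (a (1/2) t) (a (- (1/2)) t)" "inverses (b (1/2) t) (b (- (1/2)) t)"
        unfolding a_def b_def
        using binomial_series_neg_inverses[OF sm1[OF t], of "1/2"] binomial_series_neg_inverses[OF sm2[OF t], of "1/2"]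
        by simp_all
      show "star (a (1/2) t) = a (1/2) t" "star (b (1/2) t) = b (1/2) t"
        unfolding a_def b_def
        using star_binomial_series[OF star_continuous sm1[OF t], of "1/2"]
          star_binomial_series[OF star_continuous sm2[OF t], of "1/2"]
        by (simp_all add: star_simps)
      show "a (1/2) t * a (1/2) t = 1 - star (t *\<^sub>R x) * (t *\<^sub>R x)"
        unfolding a_def binomial_series_half[OF sm1[OF t]] by (simp add: star_simps power2_eq_square)
      show "b (1/2) t * b (1/2) t = 1 - (t *\<^sub>R x) * star (t *\<^sub>R x)"
        unfolding b_def binomial_series_half[OF sm2[OF t]] by (simp add: star_simps power2_eq_square)
      show "inverses (1 + l *\<^sub>C star (t *\<^sub>R x)) (r t)" using r[OF t] by (simp add: star_simps)
    qed fact
  next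
    have "r 0 = 1" using r[of 0] by (simp add: inverses_def)
    then show "norm (u 0) \<le> 1" by (simp add: u_def a_def b_def binomial_series_at_0 norm_scaleC l)
  qed
  moreover have "r 1 = R" using inverses_unique[OF R, of "r 1"] r[of 1] by (simp add: inverses_def)
  ultimately show ?thesis by (simp add: u_def a_def b_def)
qed

text \<open>By the resolvent identity the difference quotient equals - \<phi> (p R(m) y R(l) q)
  exactly, so continuity of \<open>R\<close> gives the derivative.\<close>

lemma resolvent_has_derivative:
  assumes \<phi>: "bounded_linear \<phi>" "\<And>c a. \<phi> (c *\<^sub>C a) = c * \<phi> a"
    and R: "\<And>l. l \<in> S \<Longrightarrow> inverses (1 + l *\<^sub>C y) (R l)" and S: "open S" "l \<in> S"
    and cont: "continuous_on S R"
  shows "((\<lambda>l. \<phi> (p * R l * q)) has_field_derivative - \<phi> (p * (R l * y * R l) * q)) (at l)"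
  unfolding has_field_derivative_iff
proof (rule Lim_transform_within_open[OF _ S])
  have "isCont R l" using cont S by (simp add: continuous_on_eq_continuous_at)
  then have "isCont (\<lambda>m. - \<phi> (p * (R m * y * R l) * q)) l"
    by (intro continuous_intros bounded_linear.isCont[OF \<phi>(1)])
  then show "((\<lambda>m. - \<phi> (p * (R m * y * R l) * q)) \<longlongrightarrow> - \<phi> (p * (R l * y * R l) * q)) (at l)"
    by (simp add: isCont_def)
next
  fix m assume m: "m \<in> S" "m \<noteq> l"
  have add: "\<phi> (a - b) = \<phi> a - \<phi> b" for a b
    using \<phi>(1) by (simp add: bounded_linear.linear linear_diff)
  have "R m - R l = R m * ((1 + l *\<^sub>C y) - (1 + m *\<^sub>C y)) * R l"
    using R[OF m(1)] R[OF S(2)] by (simp only: left_diff_distrib right_diff_distrib) (simp add: inverses_def mult.assoc)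
  also have "(1 + l *\<^sub>C y) - (1 + m *\<^sub>C y) = (l - m) *\<^sub>C y" by (simp add: scale_left_diff_distrib)
  finally have "R m - R l = (l - m) *\<^sub>C (R m * y * R l)" by (simp add: mult_scaleC_left mult_scaleC_right)
  then have "p * R m * q - p * R l * q = (l - m) *\<^sub>C (p * (R m * y * R l) * q)"
    by (simp add: mult_scaleC_left mult_scaleC_right flip: left_diff_distrib right_diff_distrib)
  then have "\<phi> (p * R m * q) - \<phi> (p * R l * q) = (l - m) * \<phi> (p * (R m * y * R l) * q)"
    by (simp add: \<phi>(2) flip: add)
  also have "\<dots> = - \<phi> (p * (R m * y * R l) * q) * (m - l)" by (simp add: algebra_simps)
  finally show "- \<phi> (p * (R m * y * R l) * q) = (\<phi> (p * R m * q) - \<phi> (p * R l * q)) / (m - l)"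
    using m(2) by simp
qed

text \<open>Harris: \<open>x\<close> is the value at \<open>l = 0\<close> of a holomorphic function of \<open>l\<close> whose values for \<open>cmod l = 1\<close>
  are unitary; apply the maximum modulus principle.\<close>

lemma norm_le_one:
  assumes x: "summable (\<lambda>n. norm ((star x * x) ^ n))"
  shows "norm x \<le> 1"
proof -
  obtain \<phi> where \<phi>: "bounded_linear \<phi>" "\<And>c a. \<phi> (c *\<^sub>C a) = c * \<phi> a" "\<And>a. cmod (\<phi> a) \<le> norm a"
    "norm x \<le> cmod (\<phi> x)" using norming_functional by blast
  have "\<exists>r. inverses (1 + l *\<^sub>C star x) r" if "l \<in> cball 0 1" for l
    using one_plus_scaleC_star_invertible[OF x, of l] that by auto
  then obtain R where R: "\<And>l. l \<in> cball 0 1 \<Longrightarrow> inverses (1 + l *\<^sub>C star x) (R l)" by metis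
  note cont_scaleC = bounded_linear.continuous_on[OF bounded_linear_scaleC continuous_on_id]
  have contR: "continuous_on (cball 0 1) R"
    by (rule continuous_on_inverses[OF _ R]) (intro continuous_intros cont_scaleC)
  let ?b = "binomial_series (- (1/2)) (- (x * star x))" and ?a = "binomial_series (1/2) (- (star x * x))"
  let ?F = "\<lambda>l. \<phi> (?b * (x + l *\<^sub>C 1) * R l * ?a)"
  have F_eq: "?F = (\<lambda>l. \<phi> (?b * x * R l * ?a) + l * \<phi> (?b * R l * ?a))"
    using \<phi>(1) by (simp add: fun_eq_iff distrib_left distrib_right bounded_linear.linear linear_add
        mult_scaleC_left mult_scaleC_right flip: \<phi>(2))
  have "cmod (?F 0) \<le> 1"
  proof (rule maximum_modulus_frontier[of ?F "cball 0 1"])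
    have "\<exists>D. (?F has_field_derivative D) (at l)" if l: "l \<in> ball 0 1" for l
    proof -
      have R': "inverses (1 + m *\<^sub>C star x) (R m)" if "m \<in> ball 0 1" for m using R that by auto
      have "continuous_on (ball 0 1) R" using contR by (rule continuous_on_subset) auto
      note d = resolvent_has_derivative[OF \<phi>(1,2) R' open_ball l this]
      show ?thesis unfolding F_eq
        using DERIV_add[OF d[of "?b * x" ?a] DERIV_mult[OF DERIV_ident d[of ?b ?a]]] by blast
    qed
    then show "?F holomorphic_on interior (cball 0 1)"
      by (subst interior_cball) (auto simp: holomorphic_on_open)
    show "continuous_on (closure (cball 0 1)) ?F"
      using contR by (subst closure_closed[OF closed_cball])
        (intro continuous_intros cont_scaleC bounded_linear.continuous_on[OF \<phi>(1)])
    show "bounded (cball (0::complex) 1)" by simp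
    fix l :: complex assume "l \<in> frontier (cball 0 1)"
    then have l: "cmod l = 1" by (simp add: frontier_cball)
    have "cmod (?F l) \<le> norm (?b * (x + l *\<^sub>C 1) * R l * ?a)" by (rule \<phi>(3))
    also have "\<dots> \<le> 1" using l by (intro norm_moebius_le_one x R) simp_all
    finally show "cmod (?F l) \<le> 1" .
  qed simp
  moreover have "R 0 = 1" using R[of 0] by (simp add: inverses_def)
  \<comment> \<open>At l = 0 the two outer factors cancel, because \<open>x\<close> intertwines the
    square roots of 1 - star x x and 1 - x star x.\<close>
  moreover have "?b * x * ?a = x"
  proof -
    note sm = summable_norm_power_minus[OF x] summable_norm_power_minus[OF summable_norm_power_swap[OF x]]
    have "x * ?a = binomial_series (1/2) (- (x * star x)) * x"
      by (rule binomial_series_intertwine[OF sm]) (simp_all add: mult.assoc)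
    then show ?thesis
      using binomial_series_neg_inverses[OF sm(2), of "1/2"] by (simp add: mult.assoc inverses_right)
  qed
  ultimately show ?thesis using \<phi>(4) by simp
qed

lemma norm_square_le: "(norm x)\<^sup>2 \<le> norm (star x * x)"
proof (rule field_le_epsilon)
  fix e :: real assume e: "e > 0"
  define t where "t = sqrt (norm (star x * x) + e)"
  have t: "t > 0" "t\<^sup>2 = norm (star x * x) + e" using e by (simp_all add: t_def add_nonneg_pos)
  have "star ((1/t) *\<^sub>R x) * ((1/t) *\<^sub>R x) = (1 / t\<^sup>2) *\<^sub>R (star x * x)"
    by (simp add: star_simps power2_eq_square)
  also have "norm \<dots> < 1" using t e norm_ge_zero[of "star x * x"] by (simp add: add_nonneg_pos)
  finally have "norm ((1/t) *\<^sub>R x) \<le> 1" by (intro norm_le_one summable_norm_power)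
  then have "norm x \<le> t" using t by simp
  then have "(norm x)\<^sup>2 \<le> t\<^sup>2" by (rule power_mono) simp
  then show "(norm x)\<^sup>2 \<le> norm (star x * x) + e" by (simp add: t)
qed

theorem unital_cstar_algebra: "unital_cstar_algebra scaleC star"
proof unfold_locales
  have le: "norm a \<le> norm (star a)" for a
  proof (cases "a = 0")
    case False
    have "norm a * norm a \<le> norm (star a) * norm a"
      using norm_square_le[of a] norm_mult_ineq[of "star a" a] by (simp add: power2_eq_square)
    then show ?thesis using False by simp
  qed simp
  have eq: "norm (star a) = norm a" for a
    using le[of a] le[of "star a"] by (simp add: star_star)
  fix a
  show "norm (star a * a) = (norm a)\<^sup>2"
    using norm_square_le[of a] norm_mult_ineq[of "star a" a] by (simp add: eq power2_eq_square)
qed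

end

section \<open>Positivity in \<open>C\<^sup>*\<close>-algebras\<close>

context hermitian_banach_algebra
begin

text \<open>With t^2 = s, s + k^2 = (t - i k) (t + i k), and each factor has an inverse of norm at
  most 1 / t.\<close>

lemma state_square_nonneg:
  assumes f: "real_state f" and k: "star k = k"
  shows "0 \<le> f (k * k)"
proof (rule state_nonneg_of_resolvent[OF f])
  fix s :: real assume s: "s > 0"
  define t where "t = sqrt s"
  have t: "t > 0" "t * t = s" using s by (simp_all add: t_def)
  obtain r where r: "inverses (t *\<^sub>R 1 - \<i> *\<^sub>C k) r" "norm r \<le> 1 / t"
    using resolvent_i[OF k t(1)] by blast
  have "star (- k) = - k" by (simp add: star_simps k)
  then obtain r' where "inverses (t *\<^sub>R 1 - \<i> *\<^sub>C (- k)) r'" and r': "norm r' \<le> 1 / t"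
    using resolvent_i[of "- k", OF _ t(1)] by blast
  from inverses_mult[OF r(1) this(1)]
  have "inverses ((t *\<^sub>R 1 - \<i> *\<^sub>C k) * (t *\<^sub>R 1 - \<i> *\<^sub>C (- k))) (r' * r)" .
  moreover have "(t *\<^sub>R 1 - \<i> *\<^sub>C k) * (t *\<^sub>R 1 - \<i> *\<^sub>C (- k)) = (t * t) *\<^sub>R 1 + k * k"
    by (simp add: algebra_simps mult_scaleC_left mult_scaleC_right scale_scale scaleC_scaleR)
  moreover have "norm (r' * r) \<le> 1 / s"
  proof -
    have "norm (r' * r) \<le> norm r' * norm r" by (rule norm_mult_ineq)
    also have "\<dots> \<le> 1 / t * (1 / t)" using r r' t by (intro mult_mono) auto
    finally show ?thesis using t(2) by simp
  qed
  ultimately show "\<exists>r. inverses (s *\<^sub>R 1 + k * k) r \<and> norm r \<le> 1 / s"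
    using t(2) by auto
qed

end

context unital_cstar_algebra
begin

lemma norm_star: "norm (star a) = norm a"
proof -
  have le: "norm a \<le> norm (star a)" for a
  proof (cases "a = 0")
    case False
    have "norm a * norm a \<le> norm (star a) * norm a"
      using cstar_identity[of a] norm_mult_ineq[of "star a" a] by (simp add: power2_eq_square)
    then show ?thesis using False by simp
  qed simp
  show ?thesis using le[of a] le[of "star a"] by (simp add: star_star)
qed

lemma norm_selfadjoint_square: "star a = a \<Longrightarrow> norm (a * a) = (norm a)\<^sup>2"
  using cstar_identity[of a] by simp

lemma continuous_on_star: "continuous_on UNIV star"
proof (rule continuous_onI)
  fix a and e :: real assume "e > 0"
  then show "\<exists>d>0. \<forall>b\<in>UNIV. dist b a < d \<longrightarrow> dist (star b) (star a) \<le> e"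
    by (intro exI[of _ e]) (auto simp: dist_norm norm_star simp flip: star_diff)
qed

lemma state_i_selfadjoint_nonpos:
  assumes f: "real_state f" and h: "star h = h"
  shows "f (\<i> *\<^sub>C h) \<le> 0"
proof (rule ccontr)
  assume "\<not> f (\<i> *\<^sub>C h) \<le> 0"
  define c where "c = f (\<i> *\<^sub>C h)"
  have c: "c > 0" using \<open>\<not> f (\<i> *\<^sub>C h) \<le> 0\<close> by (simp add: c_def)
  \<comment> \<open>Chosen so that t c = (norm h)^2: then (t + c)^2 \<le> t^2 + (norm h)^2 would
    give t c + c^2 \<le> 0.\<close>
  define t where "t = (norm h)\<^sup>2 / c"
  have t: "t \<ge> 0" using c by (simp add: t_def)
  let ?a = "t *\<^sub>R 1 + \<i> *\<^sub>C h"
  have "star ?a * ?a = (t * t) *\<^sub>R 1 + h * h"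
    by (simp add: star_simps h algebra_simps mult_scaleC_left mult_scaleC_right scale_scale scaleC_scaleR)
  then have "(norm ?a)\<^sup>2 \<le> t\<^sup>2 + (norm h)\<^sup>2"
    using cstar_identity[of ?a] norm_triangle_ineq[of "(t * t) *\<^sub>R 1" "h * h"] norm_mult_ineq[of h h]
    by (simp add: power2_eq_square)
  moreover have "t + c \<le> norm ?a"
    using real_state_le[OF f, of ?a] by (simp add: real_state_simps[OF f] c_def)
  then have "(t + c)\<^sup>2 \<le> (norm ?a)\<^sup>2" using t c by (intro power_mono) auto
  moreover have "t * c = (norm h)\<^sup>2" using c by (simp add: t_def)
  moreover have "c * c > 0" using c by simp
  moreover have "0 \<le> t * c" using t c by simp
  ultimately show False 
    unfolding power2_eq_square distrib_left distrib_right mult.commute[of c t] by linarith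
qed

lemma state_i_selfadjoint_zero:
  assumes f: "real_state f" and h: "star h = h"
  shows "f (\<i> *\<^sub>C h) = 0"
  using state_i_selfadjoint_nonpos[OF f h] state_i_selfadjoint_nonpos[OF f, of "- h"]
  by (simp add: star_simps h real_state_neg[OF f])

end

sublocale unital_cstar_algebra \<subseteq> hermitian_banach_algebra
  by unfold_locales (fact continuous_on_star, fact state_i_selfadjoint_zero)

section \<open>States, norm and spectrum of self-adjoint elements\<close>

context unital_cstar_algebra
begin

text \<open>With \<open>e\<^sup>2 = 1 - g\<^sup>2 - 1/K\<close>, \<open>e\<close> self-adjoint and commuting with \<open>g\<close>, the elements \<open>g \<plusminus> i e\<close> are
  \<open>sqrt (1 - 1/K)\<close> times a unitary.\<close>

lemma norm_selfadjoint_le_resolvent: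
  assumes g: "star g = g" "norm g < 1" and r: "inverses (1 - g * g) r" and K: "norm r < K" "1 \<le> K"
  shows "(norm g)\<^sup>2 \<le> 1 - 1 / K"
proof -
  have "norm (- (g * g)) < 1"
    using g norm_ge_zero[of g] by (simp add: norm_selfadjoint_square power_less_one_iff abs_square_less_1)
  note sm = summable_norm_power[OF this]
  have "norm (- ((1 / K) *\<^sub>R r)) < 1" using K by simp
  note sm' = summable_norm_power[OF this]
  \<comment> \<open>As (1 - g^2) r = 1, the product (1 - g^2) (1 - r / K) equals 1 - g^2 - 1/K. Its
    square root is therefore \<open>w * v\<close>, and \<open>norm r < K\<close> makes the series
    for \<open>v\<close> converge.\<close>
  define w where "w = binomial_series (1/2) (- (g * g))"
  define v where "v = binomial_series (1/2) (- ((1 / K) *\<^sub>R r))"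
  have sr: "star r = r" using inverses_selfadjoint[OF r] by (simp add: star_simps g)
  have sw: "star w = w" unfolding w_def
    by (rule star_binomial_series[OF continuous_on_star sm]) (simp_all add: star_simps g)
  have sv: "star v = v" unfolding v_def
    by (rule star_binomial_series[OF continuous_on_star sm']) (simp_all add: star_simps sr)
  have gw: "g * w = w * g" unfolding w_def
    by (rule binomial_series_intertwine[OF sm sm]) (simp_all add: mult.assoc)
  have gr: "r * g = g * r"
    by (rule inverses_commute[OF r]) (simp add: algebra_simps)
  then have gv: "g * v = v * g" unfolding v_def
    by (intro binomial_series_intertwine[OF sm' sm']) simp_all
  have "r * (g * g) = g * g * r"
    by (rule inverses_commute[OF r]) (simp add: algebra_simps)
  then have "r * w = w * r" unfolding w_def
    by (intro binomial_series_intertwine[OF sm sm]) simp_all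
  then have wv: "w * v = v * w" unfolding v_def
    by (intro binomial_series_intertwine[OF sm' sm']) simp_all
  have ww: "w * w = 1 - g * g" unfolding w_def by (simp add: binomial_series_half[OF sm])
  have vv: "v * v = 1 - (1 / K) *\<^sub>R r" unfolding v_def by (simp add: binomial_series_half[OF sm'])
  define e where "e = w * v"
  have se: "star e = e" by (simp add: e_def star_simps sw sv wv)
  have ge: "g * e = e * g" unfolding e_def by (metis gw gv mult.assoc)
  have "e * e = w * (v * w) * v" by (simp add: e_def mult.assoc)
  also have "\<dots> = (w * w) * (v * v)" by (simp add: wv[symmetric] mult.assoc)
  also have "\<dots> = (1 - g * g) - (1 / K) *\<^sub>R 1"
    using r by (simp add: ww vv right_diff_distrib inverses_def)
  finally have ee: "e * e = 1 - g * g - (1 / K) *\<^sub>R 1" .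
  have eq: "norm (g + c *\<^sub>C e) = sqrt (1 - 1 / K)" if c: "cnj c = - c" "c * c = - 1" for c
  proof -
    have "star (g + c *\<^sub>C e) * (g + c *\<^sub>C e) = g * g + e * e"
      using c ge by (simp add: star_simps g se distrib_left left_diff_distrib mult_scaleC_left mult_scaleC_right
          scale_scale scale_right_diff_distrib)
    also have "\<dots> = (1 - 1 / K) *\<^sub>R 1" by (simp add: ee scaleR_left_diff_distrib)
    finally have "(norm (g + c *\<^sub>C e))\<^sup>2 = 1 - 1 / K"
      using cstar_identity[of "g + c *\<^sub>C e"] K by simp
    then show ?thesis by (metis norm_ge_zero real_sqrt_unique)
  qed
  have "2 *\<^sub>R g = (g + \<i> *\<^sub>C e) + (g + (- \<i>) *\<^sub>C e)" by (simp add: scaleR_2)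
  then have "norm (2 *\<^sub>R g) \<le> norm (g + \<i> *\<^sub>C e) + norm (g + (- \<i>) *\<^sub>C e)"
    by (simp only: norm_triangle_ineq)
  then have "norm g \<le> sqrt (1 - 1 / K)" using eq[of \<i>] eq[of "- \<i>"] by simp
  then have "(norm g)\<^sup>2 \<le> (sqrt (1 - 1 / K))\<^sup>2" by (intro power_mono) auto
  then show ?thesis using K by simp
qed

text \<open>Shrink \<open>g\<close> to p g with p^2 = 1 - e. The inverse of 1 - p^2 g^2 still has
  norm at most \<open>2 * norm r < K\<close>, so the preceding estimate gives p^2 \<le> 1 - 1/K; but
  e = 1/(2 K) is smaller than 1/K.\<close>

lemma norm_one_not_invertible:
  assumes g: "star g = g" "norm g = 1"
  shows "\<not> inverses (1 - g * g) r"
proof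
  assume r: "inverses (1 - g * g) r"
  define K where "K = 2 * norm r + 1"
  define e where "e = 1 / (2 * K)"
  define p where "p = sqrt (1 - e)"
  have K: "K \<ge> 1" "2 * norm r < K" by (simp_all add: K_def)
  then have e: "0 < e" "e < 1" by (simp_all add: e_def)
  have p: "p * p = 1 - e" "0 \<le> p" "p < 1" using e by (simp_all add: p_def)
  have "1 - (p *\<^sub>R g) * (p *\<^sub>R g) - (1 - g * g) = e *\<^sub>R (g * g)"
    by (simp add: p(1) scaleR_left_diff_distrib)
  then have "norm (1 - (p *\<^sub>R g) * (p *\<^sub>R g) - (1 - g * g)) = e"
    using e g by (simp add: norm_selfadjoint_square)
  moreover have "e * norm r \<le> 1 / 2"
    using K by (simp add: e_def field_simps)
  ultimately obtain d where d: "inverses (1 - (p *\<^sub>R g) * (p *\<^sub>R g)) d" "norm d \<le> 2 * norm r"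
    using inverses_perturb[OF r, of "1 - (p *\<^sub>R g) * (p *\<^sub>R g)"] by auto
  have "(norm (p *\<^sub>R g))\<^sup>2 \<le> 1 - 1 / K"
    using d p K g by (intro norm_selfadjoint_le_resolvent[OF _ _ d(1)]) (simp_all add: star_simps)
  then have "1 - e \<le> 1 - 1 / K" using p g by (simp add: power2_eq_square)
  then show False using K by (simp add: e_def field_simps)
qed

lemma state_gap_invertible:
  fixes g :: 'a
  assumes "\<forall>f. real_state f \<longrightarrow> f g \<le> c" "\<forall>f. real_state f \<longrightarrow> - d \<le> f g" "c < 1" "d < 1"
  obtains r where "inverses (1 - g * g) r"
proof -
  obtain r where r: "inverses (1 - g) r"
    using state_bound_resolvent[OF assms(1,3)] by auto
  have "\<forall>f. real_state f \<longrightarrow> f (- g) \<le> d" using assms(2) by (auto simp: real_state_neg)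
  from state_bound_resolvent[OF this assms(4)] obtain r' where r': "inverses (1 + g) r'" by auto
  have "(1 - g) * (1 + g) = 1 - g * g" by (simp add: algebra_simps)
  then show thesis using inverses_mult[OF r r'] that by simp
qed

text \<open>Otherwise the states of g / norm g stay away from 1 and - 1, both 1 - g / norm g and 1 +
  g / norm g are invertible, and a self-adjoint element of norm 1 contradicts
  \<open>norm_one_not_invertible\<close>.\<close>

lemma norm_selfadjoint_le:
  assumes g: "star g = g" and c: "\<forall>f. real_state f \<longrightarrow> \<bar>f g\<bar> \<le> c" "0 \<le> c"
  shows "norm g \<le> c"
proof (rule ccontr)
  assume less: "\<not> norm g \<le> c"
  then have pos: "norm g > 0" using c(2) by linarith
  let ?g = "(1 / norm g) *\<^sub>R g"
  have "\<forall>f. real_state f \<longrightarrow> f ?g \<le> c / norm g" "\<forall>f. real_state f \<longrightarrow> - (c / norm g) \<le> f ?g"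
    using c pos by (auto simp: real_state_scale abs_le_iff field_simps)
  moreover have "c / norm g < 1" using less pos by simp
  ultimately obtain r where "inverses (1 - ?g * ?g) r" using state_gap_invertible by blast
  moreover have "star ?g = ?g" "norm ?g = 1" using pos g by (simp_all add: star_simps)
  ultimately show False using norm_one_not_invertible by blast
qed

text \<open>The supremum \<open>m\<close> of the states at \<open>s\<close> lies in the spectrum.
  After a shift and a scaling, \<open>g\<close> has values between 0 and 1 with supremum 1, so
  \<open>norm g = 1\<close>. Then 1 + g is invertible, and 1 - g, a multiple of m - s, cannot
  be.\<close>

lemma state_le_of_resolvent:
  assumes s: "star s = s" and c: "0 \<le> c" and inv: "\<And>l. l > c \<Longrightarrow> \<exists>r. inverses (l *\<^sub>R 1 - s) r"
    and f: "real_state f"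
  shows "f s \<le> c"
proof (rule ccontr)
  assume less: "\<not> f s \<le> c"
  define m where "m = (SUP f\<in>{f. real_state f}. f s)"
  have bdd: "bdd_above ((\<lambda>f. f s) ` {f. real_state f})"
    by (rule bdd_aboveI[of _ "norm s"]) (auto intro: real_state_le)
  have le_m: "f s \<le> m" if "real_state f" for f
    unfolding m_def using that by (intro cSUP_upper bdd) simp
  have m: "m > c" using le_m[OF f] less by simp
  define M where "M = m + norm s"
  have M: "M > 0" using m c norm_ge_zero[of s] unfolding M_def by linarith
  define g where "g = (1 / M) *\<^sub>R (s + norm s *\<^sub>R 1)"
  have sg: "star g = g" by (simp add: g_def star_simps s)
  have fg: "f g = (f s + norm s) / M" if "real_state f" for f
    using real_state_simps[OF that] by (simp add: g_def)
  have range: "0 \<le> f g" "f g \<le> 1" if "real_state f" for f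
    using le_m[OF that] real_state_abs[OF that, of s] M unfolding fg[OF that] by (auto simp: M_def abs_le_iff)
  have "norm g \<le> 1"
    using range by (intro norm_selfadjoint_le sg) (auto simp: abs_le_iff intro: order_trans[of _ 0])
  moreover have "1 \<le> norm g"
  proof -
    have "m \<le> M * norm g - norm s"
      unfolding m_def
    proof (rule cSUP_least)
      fix f' :: "'a \<Rightarrow> real" assume "f' \<in> {f. real_state f}"
      then have "(f' s + norm s) / M \<le> norm g" using real_state_le[of f' g] fg[of f'] by simp
      then show "f' s \<le> M * norm g - norm s" using M by (simp add: field_simps)
    qed (use f in auto)
    then have "M * 1 \<le> M * norm g" by (simp add: M_def)
    then show ?thesis using M by simp
  qed
  ultimately have ng: "norm g = 1" by simp
  obtain r where r: "inverses (m *\<^sub>R 1 - s) r" using inv[OF m] by blast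
  have "1 - g = (1 / M) *\<^sub>R (m *\<^sub>R 1 - s)"
  proof -
    have "(1 / M) *\<^sub>R (m *\<^sub>R 1 - s) = (1 / M) *\<^sub>R (M *\<^sub>R 1 - (s + norm s *\<^sub>R 1))"
      by (simp add: M_def algebra_simps)
    then show ?thesis using M by (simp add: g_def scaleR_right_diff_distrib)
  qed
  then obtain r1 where r1: "inverses (1 - g) r1" using inverses_scaleR[OF r, of "1 / M"] M by auto
  have "\<forall>f. real_state f \<longrightarrow> f (- g) \<le> 0" using range by (simp add: real_state_neg)
  from state_bound_resolvent[OF this, of 1] obtain r2 where r2: "inverses (1 + g) r2" by auto
  have "(1 - g) * (1 + g) = 1 - g * g" by (simp add: algebra_simps)
  then show False using inverses_mult[OF r1 r2] norm_one_not_invertible[OF sg ng] by simp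
qed

section \<open>Nonnegativity of states on \<open>star x * x\<close>\<close>

lemma state_star_add_nonneg:
  assumes f: "real_state f"
  shows "0 \<le> f (star y * y) + f (y * star y)"
proof -
  let ?h = "y + star y" and ?k = "\<i> *\<^sub>C (star y - y)"
  have "?h * ?h + ?k * ?k = 2 *\<^sub>R (star y * y + y * star y)"
    by (simp add: mult_scaleC_left mult_scaleC_right scale_scale algebra_simps scaleR_2)
  moreover have "star ?h = ?h" "star ?k = ?k"
    by (simp_all add: star_simps add.commute scale_right_diff_distrib)
  then have "0 \<le> f (?h * ?h) + f (?k * ?k)"
    using state_square_nonneg[OF f] by simp
  ultimately show ?thesis
    by (simp add: real_state_simps[OF f] flip: real_state_add[OF f])
qed

text \<open>If \<open>q = 1 + x\<^sup>* x\<close> were not invertible, then \<open>z = e (e + q\<^sup>2)\<inverse>\<close> would be an approximate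
  eigenvector, \<open>x\<^sup>* x z \<approx> - z\<close>, and \<open>y = x z\<close> would satisfy \<open>y\<^sup>* y \<approx> - z\<^sup>2\<close>.  As \<open>y\<^sup>* y\<close> and
  \<open>y y\<^sup>*\<close> have the same nonzero spectrum, both would be almost negative, although their sum is positive.\<close>

lemma one_plus_star_mult_invertible:
  obtains r where "inverses (1 + star x * x) r"
proof (rule ccontr)
  assume "\<not> thesis"
  define q where "q = 1 + star x * x"
  have noninv: "\<not> inverses q r" for r using \<open>\<not> thesis\<close> that by (auto simp: q_def)
  have sq: "star q = q" by (simp add: q_def star_simps)
  \<comment> \<open>2 e = (1/8)^2 makes \<open>norm (q * z) \<le> 1 / 8\<close>; two errors of 1/8
    then add up to 1/4, the square of the bound 1/2 in \<open>big\<close>.\<close>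
  define e :: real where "e = 1 / 128"
  have "\<forall>f. real_state f \<longrightarrow> f (- (q * q)) \<le> 0"
    using state_square_nonneg[OF _ sq] by (simp add: real_state_neg)
  from state_bound_resolvent[OF this, of e]
  obtain r where r: "inverses (e *\<^sub>R 1 + q * q) r" "norm r \<le> 1 / e" by (auto simp: e_def)
  define z where "z = e *\<^sub>R r"
  have nz: "norm z \<le> 1" using r(2) by (simp add: z_def e_def)
  have "star r = r" using inverses_selfadjoint[OF r(1)] by (simp add: star_simps sq)
  then have sz: "star z = z" by (simp add: z_def star_simps)
  have qqr: "q * q * r = 1 - z"
    using r(1) by (simp add: inverses_def distrib_right z_def algebra_simps)
  \<comment> \<open>If \<open>norm z \<le> 1 / 2\<close>, then 1 - z is invertible, and so are q^2 =
    (1 - z) (e + q^2) and its factor \<open>q\<close>.\<close>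
  have big: "norm z > 1 / 2"
  proof (rule ccontr)
    assume "\<not> norm z > 1 / 2"
    then obtain d where "inverses (1 - z) d"
      using inverses_perturb[of 1 1 "1 - z"] by (auto simp: inverses_def)
    from inverses_mult[OF this r(1)] have "inverses ((1 - z) * (e *\<^sub>R 1 + q * q)) (r * d)" .
    moreover have "(1 - z) * (e *\<^sub>R 1 + q * q) = q * q"
      using r(1) by (simp add: inverses_def z_def left_diff_distrib)
    ultimately show False using factor_of_invertible[of q q] noninv by auto
  qed
  have "star (q * z) * (q * z) = z * (e *\<^sub>R (q * q * r))"
    by (simp add: star_simps sq sz mult.assoc) (simp add: z_def)
  also have "norm \<dots> \<le> norm z * (e * norm (1 - z))"
    unfolding qqr using norm_mult_ineq[of z "e *\<^sub>R (1 - z)"] by (simp add: e_def)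
  also have "\<dots> \<le> 1 * (e * 2)"
    using nz norm_triangle_ineq4[of 1 z] by (intro mult_mono) (auto simp: e_def)
  finally have "(norm (q * z))\<^sup>2 \<le> (1 / 8)\<^sup>2"
    unfolding cstar_identity by (simp add: e_def power2_eq_square)
  then have nqz: "norm (q * z) \<le> 1 / 8" by (rule power2_le_imp_le) simp
  define y where "y = x * z"
  have yy: "star y * y = z * (q * z) - z * z"
    by (simp add: y_def q_def star_simps sz algebra_simps)
  have "norm (z * (q * z)) \<le> 1 * (1 / 8)"
    by (rule order_trans[OF norm_mult_ineq mult_mono[OF nz nqz]]) simp_all
  then have small: "f (z * (q * z)) \<le> 1 / 8" if "real_state f" for f
    using real_state_le[OF that, of "z * (q * z)"] by simp
  have zz: "0 \<le> f (z * z)" if "real_state f" for f by (rule state_square_nonneg[OF that sz])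
  have "\<forall>f. real_state f \<longrightarrow> f (star y * y) \<le> 1 / 8"
    unfolding yy using small zz by (fastforce simp: real_state_diff)
  then have inv: "\<exists>r. inverses (l *\<^sub>R 1 - y * star y) r" if l: "l > 1 / 8" for l
  proof -
    obtain r where "inverses (l *\<^sub>R 1 - star y * y) r"
      using state_bound_resolvent[OF \<open>\<forall>f. real_state f \<longrightarrow> f (star y * y) \<le> 1 / 8\<close> l] by blast
    then show ?thesis using inverses_swap[of l "star y" y r] l by auto
  qed
  have yy': "f (y * star y) \<le> 1 / 8" if "real_state f" for f
    by (rule state_le_of_resolvent[OF _ _ inv that]) (simp_all add: star_simps)
  \<comment> \<open>Substituting star y y = z q z - z^2 into the nonnegative sum gives f (z^2) \<le>
    f (z q z) + f (y star y).\<close>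
  have "f (z * z) \<le> 1 / 4" if "real_state f" for f
    using state_star_add_nonneg[OF that, of y] yy'[OF that] small[OF that]
    unfolding yy by (simp add: real_state_diff[OF that])
  then have "norm (z * z) \<le> 1 / 4"
    using zz by (intro norm_selfadjoint_le) (auto simp: star_simps sz)
  then have "(norm z)\<^sup>2 \<le> (1 / 2)\<^sup>2" by (simp add: norm_selfadjoint_square[OF sz] power2_eq_square)
  then show False using big power2_le_imp_le[of "norm z" "1 / 2"] by simp
qed

text \<open>For l > 0, l + star x x is l times 1 + star (t x) (t x) with t = 1 / sqrt l, hence
  invertible. So \<open>- (star x * x)\<close> has no positive spectrum, and its states are at most
  0.\<close>

theorem state_star_mult_nonneg:
  assumes f: "real_state f"
  shows "0 \<le> f (star x * x)"
proof -
  have "f (- (star x * x)) \<le> 0"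
  proof (rule state_le_of_resolvent[OF _ _ _ f])
    fix l :: real assume l: "l > 0"
    define t where "t = 1 / sqrt l"
    have t: "t * t * l = 1" using l by (simp add: t_def)
    obtain r where r: "inverses (1 + star (t *\<^sub>R x) * (t *\<^sub>R x)) r"
      using one_plus_star_mult_invertible by blast
    have "l *\<^sub>R (1 + star (t *\<^sub>R x) * (t *\<^sub>R x)) = l *\<^sub>R 1 - - (star x * x)"
      using t by (simp add: star_simps scaleR_add_right mult_ac)
    then show "\<exists>r. inverses (l *\<^sub>R 1 - - (star x * x)) r"
      using inverses_scaleR[OF r, of l] l by auto
  qed (simp_all add: star_simps)
  then show ?thesis by (simp add: real_state_neg[OF f])
qed

lemma positive_functional:
  assumes \<omega>: "continuous_linear_functional scaleC \<omega>" "complex_of_real (onorm \<omega>) = \<omega> 1"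
  shows "positive_functional star \<omega>"
proof (cases "onorm \<omega> = 0")
  case True
  then have "\<omega> a = 0" for a
    using onorm_eq_0[OF bounded_linear_functional[OF \<omega>(1)]] by simp
  then show ?thesis by (simp add: positive_functional_def)
next
  case False
  note st = state_of_functional[OF \<omega> False]
  have pos: "onorm \<omega> > 0"
    using onorm_pos_le[OF bounded_linear_functional[OF \<omega>(1)]] False by simp
  have "0 \<le> Re (\<omega> (star a * a))" for a
    using state_star_mult_nonneg[OF st, of a] pos by (simp add: zero_le_divide_iff)
  moreover have "Im (\<omega> (star a * a)) = 0" for a
    using state_i_selfadjoint_zero[OF st, of "star a * a"] False by (simp add: star_simps functional_scaleC[OF \<omega>(1)])
  ultimately show ?thesis
    by (simp add: positive_functional_def complex_nonneg_Reals_iff)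
qed

end

section \<open>The equivalence of the three conditions\<close>

lemma (in unital_involutive_banach_algebra) hermitian_of_real_squares:
  assumes cont: "continuous_on UNIV star"
    and real: "\<And>\<omega> a. continuous_linear_functional scaleC \<omega> \<Longrightarrow> complex_of_real (onorm \<omega>) = \<omega> 1 \<Longrightarrow>
      star a = a \<Longrightarrow> \<omega> (a\<^sup>2) \<in> \<real>"
  shows "hermitian_banach_algebra scaleC star"
proof unfold_locales
  fix f :: "'a \<Rightarrow> real" and h assume f: "real_state f" and h: "star h = h"
  let ?\<omega> = "complexify f"
  note lin = real_state_linear[OF f]
  have sq: "?\<omega> (a\<^sup>2) \<in> \<real>" if "star a = a" for a
    using real[OF state_complexify(1,2)[OF f] that] .
  have "(1 + h)\<^sup>2 = 1 + (h + h) + h\<^sup>2" by (simp add: power2_eq_square algebra_simps)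
  then have "?\<omega> ((1 + h)\<^sup>2) - ?\<omega> (h\<^sup>2) - 1 = 2 * ?\<omega> h"
    by (simp add: complexify_add[OF lin] state_complexify(3)[OF f])
  moreover have "?\<omega> ((1 + h)\<^sup>2) \<in> \<real>" "?\<omega> (h\<^sup>2) \<in> \<real>"
    by (rule sq; simp add: star_simps h)+
  ultimately have "2 * ?\<omega> h \<in> \<real>" by (metis Reals_1 Reals_diff)
  then have "Im (?\<omega> h) = 0" by (simp add: complex_is_Real_iff)
  then show "f (\<i> *\<^sub>C h) = 0" by (simp add: complexify_def)
qed (rule cont)

theorem mainTheorem1:
  fixes scaleC :: "complex \<Rightarrow> 'a::{real_normed_algebra_1, banach} \<Rightarrow> 'a"
    and star :: "'a \<Rightarrow> 'a"
  assumes "unital_involutive_banach_algebra scaleC star"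
  defines "cond1 \<equiv> continuous_on UNIV star \<and>
      (\<forall>\<omega>. continuous_linear_functional scaleC \<omega> \<and> complex_of_real (onorm \<omega>) = \<omega> 1
        \<longrightarrow> positive_functional star \<omega>)"
    and "cond2 \<equiv> continuous_on UNIV star \<and>
      (\<forall>\<omega> a. continuous_linear_functional scaleC \<omega> \<and> complex_of_real (onorm \<omega>) = \<omega> 1 \<and> star a = a
        \<longrightarrow> \<omega> (a\<^sup>2) \<in> \<real>)"
    and "cond3 \<equiv> unital_cstar_algebra scaleC star"
  shows "(cond1 \<longleftrightarrow> cond2) \<and> (cond2 \<longleftrightarrow> cond3)"
proof -
  have 12: cond2 if cond1
  proof -
    have "\<omega> (a\<^sup>2) \<in> \<real>" if "positive_functional star \<omega>" "star a = a" for \<omega> a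
    proof -
      have "\<omega> (star a * a) \<in> \<real>\<^sub>\<ge>\<^sub>0" using that(1) by (simp add: positive_functional_def)
      then show ?thesis using that(2) nonneg_Reals_subset_Reals by (auto simp: power2_eq_square)
    qed
    then show ?thesis using that by (auto simp: cond1_def cond2_def)
  qed
  have 23: cond3 if cond2
  proof -
    have "hermitian_banach_algebra scaleC star"
      using that by (intro unital_involutive_banach_algebra.hermitian_of_real_squares assms(1))
        (auto simp: cond2_def)
    then show ?thesis unfolding cond3_def by (rule hermitian_banach_algebra.unital_cstar_algebra)
  qed
  have 31: cond1 if cond3
    using that unital_cstar_algebra.continuous_on_star unital_cstar_algebra.positive_functional
    unfolding cond1_def cond3_def by blast
  show ?thesis using 12 23 31 by blast
qed

end
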